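(* Let $m\in\{1,2,\dots\}$, let $G_+\in\mathsf{G}_{m+1}$ be an expansion of some graph $G\in\mathsf{G}_m$ by the extra vertex $y_{m+1}$, and let $S^\star\subseteq S(G_+)$ be the set of distinct separators created by the expansion (note that $S^\star\cap S(G)$ may be nonempty). Then $$\mu(G_+)=\frac{\prod_{s\in A(G_+)}\nu_{G_+}(s)}{\prod_{s\in A(G)}\nu_G(s)}\;\mu(G),$$ where, for $H\in\{G,G_+\}$, $A(H)=\{s\in S(H):\ \exists\, s'\in S^\star \text{ such that } s\subseteq s'\}$ is the set of separators of $H$ contained in some separator in $S^\star$.
   Context: Graphs are finite, undirected, without loops. A clique is a complete vertex set that is maximal with respect to inclusion. A graph is decomposable if its cliques can be arranged in a junction tree, i.e. a tree whose nodes are the cliques of the graph and such that for any two cliques $c,c'$ the intersection $c\cap c'$ is contained in every node on the unique path between $c$ and $c'$. Edges of a junction tree are called links; the link $(a,b)$ has associated separator $a\cap b$ (possibly empty). All junction trees of a given decomposable graph have the same separators, with the same multiplicities (number of links with that separator); $S(G)$ denotes the set of distinct separators of $G$. Fix distinct vertices $y_1,y_2,\dots$; $\mathsf{G}_m$ is the set of decomposable graphs with vertex set $\{y_1,\dots,y_m\}$. $G_+\in\mathsf{G}_{m+1}$ is an expansion of $G\in\mathsf{G}_m$ by $y_{m+1}$ if $G_+$ is obtained from $G$ by adding the vertex $y_{m+1}$ together with some (possibly no) edges incident to it, i.e. the subgraph of $G_+$ induced by $\{y_1,\dots,y_m\}$ is $G$. A separator $s\in S(G_+)$ is created by the expansion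 if its multiplicity as a separator in $G_+$ is strictly larger than its multiplicity in $G$ (the latter being $0$ if $s\notin S(G)$). $\mu(G)$ is the number of junction trees of the decomposable graph $G$. For $s\in S(G)$ and any junction tree $T$ of $G$, let $T_s$ be the subtree of $T$ induced by the nodes containing $s$, $t_s$ its number of nodes, $m_s$ the number of links with separator $s$, and $f_1,\dots,f_{m_s+1}$ the numbers of nodes of the trees in the forest obtained from $T_s$ by deleting all links with separator $s$. Then $\nu_G(s)=t_s^{m_s-1}\prod_{j=1}^{m_s+1}f_j$, the number of ways in which the components of this forest can be connected into a single tree by adding $m_s$ links; it does not depend on the choice of $T$. Empty products equal $1$. *)

theory Defs
  imports Complex_Main "Graph_Theory.Graph_Theory"
begin

text \<open>
  Finite simple undirected graphs are the symmetric loop-free digraphs of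
  \<^locale>\<open>pair_graph\<close>: an undirected edge \<open>{u, v}\<close> is the pair of arcs \<open>(u, v)\<close>, \<open>(v, u)\<close>.
\<close>

definition complete_in :: "'a pair_pre_digraph \<Rightarrow> 'a set \<Rightarrow> bool" where
  "complete_in G C \<longleftrightarrow>
     C \<subseteq> pverts G \<and> (\<forall>u\<in>C. \<forall>v\<in>C. u \<noteq> v \<longrightarrow> (u, v) \<in> parcs G)"

definition cliques :: "'a pair_pre_digraph \<Rightarrow> 'a set set" where
  "cliques G = {C. complete_in G C \<and> (\<forall>D. complete_in G D \<longrightarrow> C \<subseteq> D \<longrightarrow> D = C)}"

text \<open>
  The predicates \<^const>\<open>forest\<close> and \<^const>\<open>tree\<close> of the digraph library do not fit here, since a pair of
  opposite arcs \<open>(u, v)\<close>, \<open>(v, u)\<close> already counts as a cycle there. In a symmetric digraph without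
  parallel arcs the undirected cycles are the cycles of length at least 3.
\<close>

definition undirected_tree :: "'a pair_pre_digraph \<Rightarrow> bool" where
  "undirected_tree T \<longleftrightarrow>
     pair_graph T \<and> connected T \<and> \<not> (\<exists>p. pre_digraph.cycle (with_proj T) p \<and> length p \<ge> 3)"

definition junction_tree :: "'a pair_pre_digraph \<Rightarrow> 'a set pair_pre_digraph \<Rightarrow> bool" where
  "junction_tree G T \<longleftrightarrow>
     undirected_tree T \<and> pverts T = cliques G \<and>
     (\<forall>p. vpath p (with_proj T) \<longrightarrow> (\<forall>d\<in>set p. hd p \<inter> last p \<subseteq> d))"

definition decomposable_graphs :: "'a set \<Rightarrow> 'a pair_pre_digraph set" where
  "decomposable_graphs V = {G. pair_graph G \<and> pverts G = V \<and> (\<exists>T. junction_tree G T)}"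

definition num_junction_trees :: "'a pair_pre_digraph \<Rightarrow> nat" where
  "num_junction_trees G = card {T. junction_tree G T}"

text \<open>A link is counted once, as an unordered pair, although it consists of two arcs.\<close>

definition links_with_separator :: "'a set pair_pre_digraph \<Rightarrow> 'a set \<Rightarrow> 'a set set set" where
  "links_with_separator T s = {{a, b} | a b. (a, b) \<in> parcs T \<and> a \<inter> b = s}"

definition separators :: "'a pair_pre_digraph \<Rightarrow> 'a set set" where
  "separators G = {s. \<exists>T. junction_tree G T \<and> links_with_separator T s \<noteq> {}}"

text \<open>
  Multiplicities and the numbers \<open>nu\<close> below are the same for all junction trees of a decomposable
  graph; \<^const>\<open>The\<close> picks this common value. The multiplicity is 0 for non-separators.
\<close>

definition multiplicity :: "'a pair_pre_digraph \<Rightarrow> 'a set \<Rightarrow> nat" where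
  "multiplicity G s = (THE k. \<forall>T. junction_tree G T \<longrightarrow> card (links_with_separator T s) = k)"

definition separator_subtree ::
    "'a set pair_pre_digraph \<Rightarrow> 'a set \<Rightarrow> ('a set, 'a set \<times> 'a set) pre_digraph" where
  "separator_subtree T s = with_proj T \<restriction> {c \<in> pverts T. s \<subseteq> c}"

definition separator_forest ::
    "'a set pair_pre_digraph \<Rightarrow> 'a set \<Rightarrow> ('a set, 'a set \<times> 'a set) pre_digraph" where
  "separator_forest T s = (separator_subtree T s)
     \<lparr>arcs := {e \<in> arcs (separator_subtree T s). fst e \<inter> snd e \<noteq> s}\<rparr>"

text \<open>
  The separator forest is symmetric, so its strongly connected components are the node sets of its
  trees. The exponent in \<open>nu_tree\<close> uses truncated subtraction, which is harmless because a separator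
  has at least one link.
\<close>

definition nu_tree :: "'a set pair_pre_digraph \<Rightarrow> 'a set \<Rightarrow> nat" where
  "nu_tree T s =
     card (verts (separator_subtree T s)) ^ (card (links_with_separator T s) - 1) *
     (\<Prod>C\<in>pre_digraph.sccs_verts (separator_forest T s). card C)"

definition nu :: "'a pair_pre_digraph \<Rightarrow> 'a set \<Rightarrow> nat" where
  "nu G s = (THE n. \<forall>T. junction_tree G T \<longrightarrow> nu_tree T s = n)"

definition expansion ::
    "'a pair_pre_digraph \<Rightarrow> 'a \<Rightarrow> 'a pair_pre_digraph \<Rightarrow> bool" where
  "expansion G v G' \<longleftrightarrow>
     v \<notin> pverts G \<and> pverts G' = insert v (pverts G) \<and>
     induced_subgraph (with_proj G) (with_proj G')"

definition created_separators ::
    "'a pair_pre_digraph \<Rightarrow> 'a pair_pre_digraph \<Rightarrow> 'a set set" where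
  "created_separators G G' = {s \<in> separators G'. multiplicity G s < multiplicity G' s}"

definition separators_below :: "'a pair_pre_digraph \<Rightarrow> 'a set set \<Rightarrow> 'a set set" where
  "separators_below H S = {s \<in> separators H. \<exists>s'\<in>S. s \<subseteq> s'}"

end

theory Submission
  imports Defs
begin

text \<open>
  For a set \<open>s\<close>, call two cliques containing \<open>s\<close> equivalent if they are joined by a chain of cliques
  in which consecutive ones meet in a proper superset of \<open>s\<close>. In every junction tree the links whose
  separator properly contains \<open>s\<close> generate exactly this equivalence, so the blocks of the forest
  attached to \<open>s\<close>, and with them multiplicities and \<open>\<nu>(s)\<close>, depend on the set of cliques only.
  A set of links is a junction tree iff for each \<open>s\<close> its links with separator \<open>s\<close> form a tree on the
  blocks of \<open>s\<close>. These choices are independent, and the number of trees on the blocks is \<open>\<nu>(s)\<close>,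
  so \<open>\<mu>(G)\<close> is the product of all \<open>\<nu>(s)\<close>.

  It remains to see that \<open>\<nu>(s)\<close> is unchanged unless \<open>s\<close> lies in a created separator. If two cliques
  of the expanded graph contain \<open>s\<close> and the new vertex \<open>v\<close>, some link between them has a separator
  containing both, and that separator is created. If there is no such clique, the cliques containing
  \<open>s\<close> are the same in both graphs. If there is exactly one such clique \<open>C\<close>, then
  \<open>C - {v}\<close> is a clique of the old graph, as otherwise it would be a created separator; replacing it
  by \<open>C\<close> turns the old cliques containing \<open>s\<close> into the new ones and keeps all intersections.
\<close>

section \<open>Classes of generated equivalence relations and forests\<close>

text \<open>The equivalence closure is taken on the whole type: a point untouched by
  \<open>r\<close> is a class of its own, and a carrier enters only through quotients
  \<open>V // eqcl r\<close>.\<close>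

definition eqcl :: "'b rel \<Rightarrow> 'b rel" where
  "eqcl r = (r \<union> r\<inverse>)\<^sup>*"

definition edge_rel :: "'b set set \<Rightarrow> 'b rel" where
  "edge_rel F = {(a, b). {a, b} \<in> F}"

definition all_pairs :: "'b set \<Rightarrow> 'b set set" where
  "all_pairs V = {{a, b} | a b. a \<in> V \<and> b \<in> V \<and> a \<noteq> b}"

text \<open>For \<open>r = edge_rel F\<close> with \<open>F \<subseteq> all_pairs V\<close> this is
  the number of connected components of the graph \<open>(V, F)\<close>, isolated vertices
  included.\<close>

definition num_classes :: "'b set \<Rightarrow> 'b rel \<Rightarrow> nat" where
  "num_classes V r = card (V // eqcl r)"

lemma eqcl_refl [simp]: "(x, x) \<in> eqcl r"
  by (simp add: eqcl_def)

lemma eqcl_sym: "(x, y) \<in> eqcl r \<Longrightarrow> (y, x) \<in> eqcl r"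
proof -
  have "sym (eqcl r)"
    unfolding eqcl_def by (rule sym_rtrancl) (rule sym_Un_converse)
  then show "(x, y) \<in> eqcl r \<Longrightarrow> (y, x) \<in> eqcl r" by (rule symD)
qed

lemma eqcl_trans: "(x, y) \<in> eqcl r \<Longrightarrow> (y, z) \<in> eqcl r \<Longrightarrow> (x, z) \<in> eqcl r"
  unfolding eqcl_def by (rule rtrancl_trans)

lemma eqcl_base: "(x, y) \<in> r \<Longrightarrow> (x, y) \<in> eqcl r"
  by (auto simp: eqcl_def)

lemma eqcl_cong:
  assumes "(u, v) \<in> eqcl r"
  shows "(x, u) \<in> eqcl r \<longleftrightarrow> (x, v) \<in> eqcl r" "(u, x) \<in> eqcl r \<longleftrightarrow> (v, x) \<in> eqcl r"
  using assms eqcl_sym eqcl_trans by metis+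

lemma equiv_eqcl: "equiv UNIV (eqcl r)"
  by (auto intro!: equivI refl_onI symI transI intro: eqcl_sym eqcl_trans)

lemma eqcl_induct [consumes 1, case_names refl step conv]:
  assumes "(x, y) \<in> eqcl r" and "P x"
    and "\<And>u v. (x, u) \<in> eqcl r \<Longrightarrow> (u, v) \<in> r \<Longrightarrow> P u \<Longrightarrow> P v"
    and "\<And>u v. (x, u) \<in> eqcl r \<Longrightarrow> (v, u) \<in> r \<Longrightarrow> P u \<Longrightarrow> P v"
  shows "P y"
  using assms(1) unfolding eqcl_def
  by (induction rule: rtrancl_induct) (use assms(2-) in \<open>auto simp: eqcl_def\<close>)

text \<open>Universal property of the closure: an inclusion between generated equivalences only has
  to be checked on generators.\<close>

lemma eqcl_least:
  assumes "r \<subseteq> eqcl q" shows "eqcl r \<subseteq> eqcl q"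
proof (clarify)
  fix x y assume "(x, y) \<in> eqcl r"
  then show "(x, y) \<in> eqcl q"
    by (induction rule: eqcl_induct) (use assms in \<open>auto intro: eqcl_trans eqcl_sym\<close>)
qed

lemma eqcl_mono: "r \<subseteq> q \<Longrightarrow> eqcl r \<subseteq> eqcl q"
  by (rule eqcl_least) (auto intro: eqcl_base)

lemma eqcl_closed:
  assumes "(x, y) \<in> eqcl r" "r \<subseteq> V \<times> V" "x \<in> V" shows "y \<in> V"
  using assms(1) by (induction rule: eqcl_induct) (use assms in auto)

lemma eqcl_empty [simp]: "eqcl {} = Id"
  by (simp add: eqcl_def)

lemma eqcl_Un_cong:
  assumes "eqcl r = eqcl q" shows "eqcl (r \<union> t) = eqcl (q \<union> t)"
proof -
  have *: "eqcl (r' \<union> t) \<subseteq> eqcl (q' \<union> t)" if "eqcl r' = eqcl q'" for r' q' :: "'a rel"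
  proof (rule eqcl_least, rule subrelI)
    fix x y assume "(x, y) \<in> r' \<union> t"
    then have "(x, y) \<in> eqcl q' \<or> (x, y) \<in> t" using eqcl_base[of x y r'] that by auto
    then show "(x, y) \<in> eqcl (q' \<union> t)"
      using subsetD[OF eqcl_mono[of q' "q' \<union> t"]] eqcl_base[of x y "q' \<union> t"] by auto
  qed
  show ?thesis using *[OF assms] *[OF assms[symmetric]] by (rule equalityI)
qed

section \<open>Relations generated by edge sets and the effect of one more edge\<close>

lemma edge_rel_mono: "F \<subseteq> H \<Longrightarrow> edge_rel F \<subseteq> edge_rel H"
  by (auto simp: edge_rel_def)

lemma edge_rel_sub: "F \<subseteq> all_pairs V \<Longrightarrow> edge_rel F \<subseteq> V \<times> V"
  unfolding edge_rel_def all_pairs_def by (auto simp: doubleton_eq_iff)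

lemma finite_all_pairs: "finite V \<Longrightarrow> finite (all_pairs V)"
  by (rule finite_subset[of _ "Pow V"]) (auto simp: all_pairs_def)

lemma edge_rel_insert:
  "edge_rel (insert {a, b} F) = insert (a, b) (insert (b, a) (edge_rel F))"
  by (auto simp: edge_rel_def doubleton_eq_iff)

lemma edge_rel_empty [simp]: "edge_rel {} = {}"
  by (simp add: edge_rel_def)

lemma eqcl_insert_edge:
  "eqcl (r \<union> edge_rel (insert {a, b} F)) = eqcl (insert (a, b) (r \<union> edge_rel F))"
  unfolding edge_rel_insert
  by (intro equalityI eqcl_least)
     (auto intro: eqcl_base eqcl_sym[OF eqcl_base])

text \<open>The new pair merges the class of \<open>a\<close> with the class of \<open>b\<close> and
  touches no other class; a step along any other pair stays inside an old class.\<close>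

lemma eqcl_insert_iff:
  "(x, y) \<in> eqcl (insert (a, b) r) \<longleftrightarrow> (x, y) \<in> eqcl r \<or>
     ((x, a) \<in> eqcl r \<or> (x, b) \<in> eqcl r) \<and> ((y, a) \<in> eqcl r \<or> (y, b) \<in> eqcl r)"
  (is "?L \<longleftrightarrow> ?R x y")
proof
  assume ?L
  then show "?R x y"
  proof (induction rule: eqcl_induct)
    case refl then show ?case by simp
  next
    case (step u v)
    show ?case
    proof (cases "(u, v) = (a, b)")
      case True then show ?thesis using step(3) by auto
    next
      case False
      then have "(u, v) \<in> eqcl r" using step(2) by (auto intro: eqcl_base)
      then show ?thesis using step(3) eqcl_cong by metis
    qed
  next
    case (conv u v)
    show ?case
    proof (cases "(v, u) = (a, b)")
      case True then show ?thesis using conv(3) by auto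
    next
      case False
      then have "(v, u) \<in> eqcl r" using conv(2) by (auto intro: eqcl_base)
      then show ?thesis using conv(3) eqcl_cong by metis
    qed
  qed
next
  have m: "eqcl r \<subseteq> eqcl (insert (a, b) r)" by (rule eqcl_mono) auto
  have ab: "(a, b) \<in> eqcl (insert (a, b) r)" by (rule eqcl_base) simp
  assume "?R x y"
  then show ?L by (meson m ab subsetD eqcl_sym eqcl_trans)
qed

lemma eqcl_insert_redundant: "(a, b) \<in> eqcl r \<Longrightarrow> eqcl (insert (a, b) r) = eqcl r"
  by (intro equalityI eqcl_least) (auto intro: eqcl_base)

lemma eqcl_class_eq: "eqcl r `` {x} = eqcl r `` {y} \<longleftrightarrow> (x, y) \<in> eqcl r"
  using eq_equiv_class_iff[OF equiv_eqcl, of x y r] by simp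

lemma quotient_image: "V // R = (\<lambda>x. R `` {x}) ` V"
  by (auto simp: quotient_def)

lemma class_mem: "C \<in> V // eqcl r \<Longrightarrow> x \<in> C \<Longrightarrow> C = eqcl r `` {x}"
  unfolding quotient_image by (elim imageE) (simp add: eqcl_class_eq)

text \<open>Two classes are replaced by their union. If \<open>a\<close> and \<open>b\<close> were
  already equivalent, the class taken out is the one put back, so the formula covers this case as
  well.\<close>

lemma quotient_insert:
  assumes "a \<in> V" "b \<in> V"
  shows "V // eqcl (insert (a, b) r) =
    insert (eqcl r `` {a} \<union> eqcl r `` {b}) (V // eqcl r - {eqcl r `` {a}, eqcl r `` {b}})"
proof -
  let ?A = "eqcl r `` {a}" and ?B = "eqcl r `` {b}"
  have cl: "eqcl (insert (a, b) r) `` {x} = (if x \<in> ?A \<union> ?B then ?A \<union> ?B else eqcl r `` {x})" for x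
    by (rule set_eqI) (simp add: eqcl_insert_iff, use eqcl_cong eqcl_sym in metis)
  show ?thesis
    unfolding quotient_image cl
  proof (intro equalityI subsetI)
    fix C assume "C \<in> (\<lambda>x. if x \<in> ?A \<union> ?B then ?A \<union> ?B else eqcl r `` {x}) ` V"
    then obtain x where x: "x \<in> V" "C = (if x \<in> ?A \<union> ?B then ?A \<union> ?B else eqcl r `` {x})"
      by blast
    show "C \<in> insert (?A \<union> ?B) ((\<lambda>x. eqcl r `` {x}) ` V - {?A, ?B})"
      using x by (auto simp: eqcl_class_eq split: if_splits dest: eqcl_sym)
  next
    fix C assume C: "C \<in> insert (?A \<union> ?B) ((\<lambda>x. eqcl r `` {x}) ` V - {?A, ?B})"
    show "C \<in> (\<lambda>x. if x \<in> ?A \<union> ?B then ?A \<union> ?B else eqcl r `` {x}) ` V"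
    proof (cases "C = ?A \<union> ?B")
      case True then show ?thesis using assms by (intro image_eqI[of _ _ a]) auto
    next
      case False
      then obtain x where x: "x \<in> V" "C = eqcl r `` {x}" and ne: "?A \<noteq> C" "?B \<noteq> C"
        using C by blast
      have "x \<notin> ?A \<union> ?B" using ne unfolding x(2) eqcl_class_eq by simp
      then show ?thesis using x by (intro image_eqI[of _ _ x]) simp_all
    qed
  qed
qed

text \<open>A class containing \<open>a\<close> is the class of \<open>a\<close>, so the union could
  be an old class only if \<open>b\<close> were already equivalent to \<open>a\<close>.\<close>

lemma merged_class_new:
  assumes "(a, b) \<notin> eqcl r" shows "eqcl r `` {a} \<union> eqcl r `` {b} \<notin> V // eqcl r"
proof
  assume C: "eqcl r `` {a} \<union> eqcl r `` {b} \<in> V // eqcl r"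
  have "eqcl r `` {a} \<union> eqcl r `` {b} = eqcl r `` {a}" by (rule class_mem[OF C]) simp
  then have "b \<in> eqcl r `` {a}" by (metis UnCI ImageI eqcl_refl singletonI)
  then show False using assms by simp
qed

lemma num_classes_insert:
  assumes "finite V" "a \<in> V" "b \<in> V"
  shows "num_classes V r = (if (a, b) \<in> eqcl r then 0 else 1) + num_classes V (insert (a, b) r)"
proof (cases "(a, b) \<in> eqcl r")
  case True then show ?thesis by (simp add: num_classes_def eqcl_insert_redundant)
next
  case False
  let ?A = "eqcl r `` {a}" and ?B = "eqcl r `` {b}" and ?Q = "V // eqcl r"
  have fin: "finite ?Q" using assms by (simp add: quotient_image)
  have AB: "?A \<in> ?Q" "?B \<in> ?Q" "?A \<noteq> ?B"
    using assms False by (auto simp: quotient_image eqcl_class_eq)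
  have "num_classes V (insert (a, b) r) = Suc (card (?Q - {?A, ?B}))"
    unfolding num_classes_def quotient_insert[OF assms(2,3)]
    by (subst card_insert_disjoint) (use fin merged_class_new[OF False, of V] in auto)
  also have "card (?Q - {?A, ?B}) = card ?Q - 2"
    using AB by (subst card_Diff_subset) auto
  finally have "num_classes V (insert (a, b) r) = Suc (card ?Q - 2)" .
  moreover have "card ?Q \<ge> 2"
    using card_mono[OF fin, of "{?A, ?B}"] AB by simp
  ultimately show ?thesis using False by (simp add: num_classes_def)
qed

section \<open>Component counts and acyclic edge sets\<close>

lemma all_pairsE:
  assumes "e \<in> all_pairs V"
  obtains a b where "e = {a, b}" "a \<in> V" "b \<in> V" "a \<noteq> b"
  using assms by (auto simp: all_pairs_def)

lemma num_classes_edges: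
  assumes "finite V" "F \<subseteq> all_pairs V"
  shows "num_classes V r \<le> num_classes V (r \<union> edge_rel F) + card F"
proof -
  have "finite F" using assms finite_all_pairs finite_subset by blast
  then show ?thesis using assms(2)
  proof (induction F)
    case empty then show ?case by simp
  next
    case (insert e F)
    then obtain a b where e: "e = {a, b}" "a \<in> V" "b \<in> V" by (auto elim: all_pairsE)
    have "num_classes V (r \<union> edge_rel F) \<le> 1 + num_classes V (r \<union> edge_rel (insert e F))"
      using num_classes_insert[OF assms(1) e(2,3), of "r \<union> edge_rel F"]
      unfolding e(1) by (simp add: num_classes_def eqcl_insert_edge)
    then show ?case using insert by simp
  qed
qed

lemma num_classes_Id: "num_classes V {} = card V"
proof -
  have "V // Id = (\<lambda>x. {x}) ` V" by (auto simp: quotient_image)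
  then show ?thesis by (simp add: num_classes_def card_image)
qed

lemma num_classes_one:
  assumes "V \<noteq> {}" "\<And>x y. x \<in> V \<Longrightarrow> y \<in> V \<Longrightarrow> (x, y) \<in> eqcl r"
  shows "num_classes V r = 1"
proof -
  obtain x where x: "x \<in> V" using assms by auto
  have "(\<lambda>y. eqcl r `` {y}) ` V = (\<lambda>y. eqcl r `` {x}) ` V"
    by (rule image_cong) (use x assms(2) in \<open>simp_all add: eqcl_class_eq\<close>)
  also have "\<dots> = {eqcl r `` {x}}" using x by blast
  finally have "V // eqcl r = {eqcl r `` {x}}" by (simp only: quotient_image)
  then show ?thesis by (simp add: num_classes_def)
qed

lemma num_classes_le_one:
  assumes "finite V" "num_classes V r \<le> 1" "x \<in> V" "y \<in> V"
  shows "(x, y) \<in> eqcl r"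
proof -
  have "finite (V // eqcl r)" using assms by (simp add: quotient_image)
  moreover have "eqcl r `` {x} \<in> V // eqcl r" "eqcl r `` {y} \<in> V // eqcl r"
    using assms by (auto simp: quotient_image)
  ultimately have "eqcl r `` {x} = eqcl r `` {y}"
    using assms(2) card_le_Suc0_iff_eq[of "V // eqcl r"] unfolding num_classes_def by auto
  then show ?thesis by (simp add: eqcl_class_eq)
qed

text \<open>Acyclicity by counting: this is equality in \<open>num_classes_edges\<close> for
  \<open>r = {}\<close>, where every vertex starts as its own class.\<close>

definition forest_edges :: "'b set \<Rightarrow> 'b set set \<Rightarrow> bool" where
  "forest_edges V L \<longleftrightarrow> L \<subseteq> all_pairs V \<and> num_classes V (edge_rel L) + card L = card V"

lemma edge_rel_Un: "edge_rel (F \<union> H) = edge_rel F \<union> edge_rel H"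
  by (auto simp: edge_rel_def)

text \<open>Each edge of \<open>F\<close> and each edge of \<open>L - F\<close> lowers the number of
  components by at most one. For \<open>L\<close> the two bounds add up to an equality, so both are
  tight.\<close>

lemma forest_edges_subset:
  assumes "finite V" "forest_edges V L" "F \<subseteq> L" shows "forest_edges V F"
proof -
  have L: "L \<subseteq> all_pairs V" "num_classes V (edge_rel L) + card L = card V"
    using assms(2) by (auto simp: forest_edges_def)
  have fin: "finite L" using L finite_all_pairs[OF assms(1)] finite_subset by blast
  have "card V \<le> num_classes V (edge_rel F) + card F"
    using num_classes_edges[OF assms(1), of F "{}"] L assms(3) by (simp add: num_classes_Id)
  moreover have "num_classes V (edge_rel F) \<le> num_classes V (edge_rel L) + card (L - F)"
    using num_classes_edges[OF assms(1), of "L - F" "edge_rel F"] L assms(3)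
    by (simp add: edge_rel_Un[symmetric] Un_absorb1) auto
  moreover have "card (L - F) = card L - card F" "card F \<le> card L"
    using fin assms(3) by (auto simp: card_Diff_subset finite_subset card_mono)
  ultimately show ?thesis using L assms(3) by (auto simp: forest_edges_def)
qed

text \<open>A set of edges is acyclic iff every edge is a bridge. Removing a non-bridge would keep
  the components but not the edge count; conversely, adding bridges one at a time merges two
  components each time. The right-hand side does not mention \<open>V\<close>, which later permits a
  change of vertex set.\<close>

lemma forest_edges_iff:
  assumes "finite V" "L \<subseteq> all_pairs V"
  shows "forest_edges V L \<longleftrightarrow> (\<forall>a b. {a, b} \<in> L \<longrightarrow> (a, b) \<notin> eqcl (edge_rel (L - {{a, b}})))"
proof
  assume f: "forest_edges V L"
  show "\<forall>a b. {a, b} \<in> L \<longrightarrow> (a, b) \<notin> eqcl (edge_rel (L - {{a, b}}))"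
  proof (intro allI impI notI)
    fix a b assume e: "{a, b} \<in> L" and c: "(a, b) \<in> eqcl (edge_rel (L - {{a, b}}))"
    have "insert {a, b} (L - {{a, b}}) = L" using e by auto
    then have "eqcl (edge_rel L) = eqcl (edge_rel (L - {{a, b}}))"
      using eqcl_insert_edge[of "{}" a b "L - {{a, b}}"] eqcl_insert_redundant[OF c] by simp
    moreover have "forest_edges V (L - {{a, b}})"
      by (rule forest_edges_subset[OF assms(1) f]) auto
    moreover have "finite L" using assms finite_all_pairs finite_subset by blast
    then have "card L = Suc (card (L - {{a, b}}))" using e by (metis card.remove)
    ultimately show False using f by (simp add: forest_edges_def num_classes_def)
  qed
next
  have "finite L" using assms finite_all_pairs finite_subset by blast
  moreover assume "\<forall>a b. {a, b} \<in> L \<longrightarrow> (a, b) \<notin> eqcl (edge_rel (L - {{a, b}}))"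
  ultimately show "forest_edges V L" using assms(2)
  proof (induction L)
    case empty then show ?case by (simp add: forest_edges_def num_classes_Id)
  next
    case (insert e F)
    then obtain a b where e: "e = {a, b}" "a \<in> V" "b \<in> V" by (auto elim: all_pairsE)
    have "forest_edges V F"
    proof (rule insert.IH)
      show "\<forall>c d. {c, d} \<in> F \<longrightarrow> (c, d) \<notin> eqcl (edge_rel (F - {{c, d}}))"
      proof (intro allI impI notI)
        fix c d assume "{c, d} \<in> F" "(c, d) \<in> eqcl (edge_rel (F - {{c, d}}))"
        moreover have "eqcl (edge_rel (F - {{c, d}})) \<subseteq> eqcl (edge_rel (insert e F - {{c, d}}))"
          by (intro eqcl_mono edge_rel_mono) auto
        ultimately show False using insert.prems(1) by blast
      qed
    qed (use insert in auto)
    moreover have "insert e F - {{a, b}} = F" using e insert by auto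
    then have "(a, b) \<notin> eqcl (edge_rel F)" using insert.prems(1) e by (metis insertI1)
    ultimately show ?case
      using num_classes_insert[OF assms(1) e(2,3), of "edge_rel F"] insert.hyps insert.prems(2)
        eqcl_insert_edge[of "{}" a b F] unfolding e(1)
      by (simp add: forest_edges_def num_classes_def)
  qed
qed

section \<open>Counting the trees on the blocks of a partition\<close>

text \<open>After contraction of the classes of \<open>r\<close> these are spanning trees:
  connectivity together with one edge fewer than classes. Edges keep their original endpoints, so
  different edges between the same two classes give different sets.\<close>

definition connecting_sets :: "'b set \<Rightarrow> 'b rel \<Rightarrow> 'b set set set" where
  "connecting_sets V r = {F. F \<subseteq> all_pairs V \<and> card F + 1 = num_classes V r \<and>
     (\<forall>x\<in>V. \<forall>y\<in>V. (x, y) \<in> eqcl (r \<union> edge_rel F))}"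

lemma finite_connecting_sets: "finite V \<Longrightarrow> finite (connecting_sets V r)"
  by (rule finite_subset[of _ "Pow (all_pairs V)"])
     (auto simp: connecting_sets_def finite_all_pairs)

lemma connecting_sets_finite: "finite V \<Longrightarrow> F \<in> connecting_sets V r \<Longrightarrow> finite F"
  using finite_all_pairs[of V] finite_subset[of F "all_pairs V"] by (simp add: connecting_sets_def)

text \<open>An edge inside a class could be dropped without losing connectivity, and the remaining
  edges would be too few to join all classes.\<close>

lemma connecting_sets_edge_cross:
  assumes "finite V" "F \<in> connecting_sets V r" "{a, b} \<in> F"
  shows "(a, b) \<notin> eqcl r"
proof
  assume ab: "(a, b) \<in> eqcl r"
  let ?F = "F - {{a, b}}"
  have F: "F \<subseteq> all_pairs V" "card F + 1 = num_classes V r"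
    "\<And>x y. x \<in> V \<Longrightarrow> y \<in> V \<Longrightarrow> (x, y) \<in> eqcl (r \<union> edge_rel F)"
    using assms(2) by (auto simp: connecting_sets_def)
  have "V \<noteq> {}" using F(1) assms(3) by (auto simp: all_pairs_def)
  have ins: "insert {a, b} ?F = F" using assms(3) by auto
  have "(a, b) \<in> eqcl (r \<union> edge_rel ?F)" using ab eqcl_mono[of r "r \<union> edge_rel ?F"] by auto
  then have eq: "eqcl (r \<union> edge_rel F) = eqcl (r \<union> edge_rel ?F)"
    using eqcl_insert_edge[of r a b ?F] eqcl_insert_redundant unfolding ins by simp
  have "num_classes V (r \<union> edge_rel ?F) = 1"
    by (rule num_classes_one[OF \<open>V \<noteq> {}\<close>]) (use F(3) eq in simp)
  moreover have "num_classes V r \<le> num_classes V (r \<union> edge_rel ?F) + card ?F"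
    by (rule num_classes_edges[OF assms(1)]) (use F in auto)
  moreover have "card F = Suc (card ?F)"
    using connecting_sets_finite[OF assms(1,2)] assms(3) by (metis card.remove)
  ultimately show False using F(2) by simp
qed

lemma card_edge_rel:
  assumes "finite F" "F \<subseteq> all_pairs V"
  shows "finite (edge_rel F) \<and> card (edge_rel F) = 2 * card F"
  using assms
proof (induction F)
  case empty then show ?case by simp
next
  case (insert e F)
  then obtain a b where e: "e = {a, b}" "a \<noteq> b" by (auto elim: all_pairsE)
  have "(a, b) \<notin> insert (b, a) (edge_rel F)" "(b, a) \<notin> edge_rel F"
    using insert.hyps e by (auto simp: edge_rel_def insert_commute)
  then show ?case using insert unfolding e(1) edge_rel_insert by simp
qed

lemma class_nonempty [simp]: "eqcl r `` {x} \<noteq> {}"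
  using eqcl_refl[of x r] by blast

lemma class_subset: "r \<subseteq> V \<times> V \<Longrightarrow> x \<in> V \<Longrightarrow> eqcl r `` {x} \<subseteq> V"
  using eqcl_closed by fastforce

text \<open>A class \<open>C\<close> contributes \<open>card C\<close> summands equal to
  \<open>1 / card C\<close>.\<close>

lemma sum_inverse_class_card:
  assumes "finite V" "r \<subseteq> V \<times> V"
  shows "(\<Sum>x\<in>V. 1 / real (card (eqcl r `` {x}))) = real (num_classes V r)"
proof -
  have cls: "{x \<in> V. eqcl r `` {x} = C} = C" if C: "C \<in> V // eqcl r" for C
  proof -
    obtain c where c: "c \<in> V" "C = eqcl r `` {c}" using C by (auto simp: quotient_image)
    have "C \<subseteq> V" using class_subset[OF assms(2) c(1)] c(2) by simp
    moreover have "x \<in> C" if "eqcl r `` {x} = C" for x using that eqcl_refl[of x r] by blast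
    moreover have "eqcl r `` {x} = C" if "x \<in> C" for x using class_mem[OF C that] by (rule sym)
    ultimately show ?thesis by blast
  qed
  have "(\<Sum>x\<in>V. 1 / real (card (eqcl r `` {x})))
      = (\<Sum>C\<in>V // eqcl r. \<Sum>x\<in>{x \<in> V. eqcl r `` {x} = C}. 1 / real (card (eqcl r `` {x})))"
    unfolding quotient_image by (rule sum.image_gen[OF assms(1)])
  also have "\<dots> = (\<Sum>C\<in>V // eqcl r. 1)"
  proof (rule sum.cong[OF refl])
    fix C assume C: "C \<in> V // eqcl r"
    have "C \<subseteq> V" using cls[OF C] by auto
    then have "finite C" using assms(1) finite_subset by blast
    moreover have "C \<noteq> {}" using C by (auto simp: quotient_image)
    ultimately have "real (card C) \<noteq> 0" by simp
    have "(\<Sum>x\<in>{x \<in> V. eqcl r `` {x} = C}. 1 / real (card (eqcl r `` {x})))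
        = (\<Sum>x\<in>{x \<in> V. eqcl r `` {x} = C}. 1 / real (card C))"
      by (rule sum.cong) auto
    also have "\<dots> = 1" using \<open>real (card C) \<noteq> 0\<close> unfolding cls[OF C] by simp
    finally show "(\<Sum>x\<in>{x \<in> V. eqcl r `` {x} = C}. 1 / real (card (eqcl r `` {x}))) = 1" .
  qed
  finally show ?thesis by (simp add: num_classes_def)
qed

text \<open>For fixed \<open>a\<close> there are \<open>card V\<close> minus the size of its class
  choices of \<open>b\<close>, so the first summands add up to \<open>card V\<close> over that size,
  minus one. Summing over \<open>a\<close> gives half of the total; swapping \<open>a\<close> and
  \<open>b\<close> gives the other half.\<close>

lemma sum_inverse_class_cross:
  assumes "finite V" "r \<subseteq> V \<times> V"
  shows "(\<Sum>(a, b)\<in>V \<times> V - eqcl r. 1 / real (card (eqcl r `` {a})) + 1 / real (card (eqcl r `` {b})))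
     = 2 * (real (card V) * (real (num_classes V r) - 1))"
proof -
  let ?f = "\<lambda>x. real (card (eqcl r `` {x}))" and ?Y = "V \<times> V - eqcl r"
  have "?Y = (SIGMA a:V. V - eqcl r `` {a})" by auto
  then have "(\<Sum>(a, b)\<in>?Y. 1 / ?f a) = (\<Sum>a\<in>V. \<Sum>b\<in>V - eqcl r `` {a}. 1 / ?f a)"
    using assms(1) by (subst sum.Sigma) auto
  also have "\<dots> = (\<Sum>a\<in>V. real (card V) * (1 / ?f a) - 1)"
  proof (rule sum.cong[OF refl])
    fix a assume a: "a \<in> V"
    have sub: "eqcl r `` {a} \<subseteq> V" by (rule class_subset[OF assms(2) a])
    then have fin: "finite (eqcl r `` {a})" using assms(1) finite_subset by blast
    have "a \<in> eqcl r `` {a}" by simp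
    then have pos: "?f a > 0" using fin by (metis card_gt_0_iff empty_iff of_nat_0_less_iff)
    have "real (card (V - eqcl r `` {a})) = real (card V) - ?f a"
      using sub assms(1) fin by (simp add: card_Diff_subset card_mono of_nat_diff)
    then show "(\<Sum>b\<in>V - eqcl r `` {a}. 1 / ?f a) = real (card V) * (1 / ?f a) - 1"
      using pos by (simp add: field_simps)
  qed
  also have "\<dots> = real (card V) * (real (num_classes V r) - 1)"
    by (simp only: sum_subtractf sum_distrib_left[symmetric] sum_inverse_class_card[OF assms])
       (simp add: algebra_simps)
  finally have 1: "(\<Sum>(a, b)\<in>?Y. 1 / ?f a) = real (card V) * (real (num_classes V r) - 1)" .
  have "(\<Sum>(a, b)\<in>?Y. 1 / ?f b) = (\<Sum>(a, b)\<in>?Y. 1 / ?f a)"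
    by (rule sum.reindex_bij_witness[of _ prod.swap prod.swap]) (auto intro: eqcl_sym)
  then show ?thesis using 1 by (simp add: case_prod_unfold sum.distrib)
qed

text \<open>Contraction of an edge: removing \<open>{a, b}\<close> from \<open>F\<close> and adding
  \<open>(a, b)\<close> to \<open>r\<close> preserves the generated equivalence and lowers both the
  edge count and the class count by one.\<close>

lemma card_connecting_sets_containing:
  assumes "finite V" "a \<in> V" "b \<in> V" "(a, b) \<notin> eqcl r"
  shows "card {F \<in> connecting_sets V r. {a, b} \<in> F} = card (connecting_sets V (insert (a, b) r))"
proof (rule bij_betw_same_card[OF bij_betw_byWitness[where f = "\<lambda>F. F - {{a, b}}" and f' = "insert {a, b}"]])
  have ab: "a \<noteq> b" using assms(4) by auto
  have num: "num_classes V r = Suc (num_classes V (insert (a, b) r))"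
    using num_classes_insert[OF assms(1-3), of r] assms(4) by simp
  have eq: "eqcl (r \<union> edge_rel (insert {a, b} F)) = eqcl (insert (a, b) r \<union> edge_rel F)" for F
    by (simp add: eqcl_insert_edge)
  have notin: "{a, b} \<notin> F" if "F \<in> connecting_sets V (insert (a, b) r)" for F
    using connecting_sets_edge_cross[OF assms(1) that] eqcl_base[of a b "insert (a, b) r"] by auto
  show "\<forall>F\<in>{F \<in> connecting_sets V r. {a, b} \<in> F}. insert {a, b} (F - {{a, b}}) = F" by auto
  show "\<forall>F\<in>connecting_sets V (insert (a, b) r). insert {a, b} F - {{a, b}} = F"
    using notin by auto
  show "(\<lambda>F. F - {{a, b}}) ` {F \<in> connecting_sets V r. {a, b} \<in> F}
      \<subseteq> connecting_sets V (insert (a, b) r)"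
  proof clarify
    fix F assume F: "F \<in> connecting_sets V r" "{a, b} \<in> F"
    have "card F = Suc (card (F - {{a, b}}))"
      using connecting_sets_finite[OF assms(1) F(1)] F(2) by (metis card.remove)
    moreover have "insert {a, b} (F - {{a, b}}) = F" using F by auto
    ultimately show "F - {{a, b}} \<in> connecting_sets V (insert (a, b) r)"
      using F(1) num eq[of "F - {{a, b}}"] unfolding connecting_sets_def by auto
  qed
  show "insert {a, b} ` connecting_sets V (insert (a, b) r)
      \<subseteq> {F \<in> connecting_sets V r. {a, b} \<in> F}"
  proof clarify
    fix F assume F: "F \<in> connecting_sets V (insert (a, b) r)"
    have "card (insert {a, b} F) = Suc (card F)"
      using connecting_sets_finite[OF assms(1) F] notin[OF F] by simp
    moreover have "{a, b} \<in> all_pairs V" using assms ab by (auto simp: all_pairs_def)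
    ultimately show "insert {a, b} F \<in> connecting_sets V r \<and> {a, b} \<in> insert {a, b} F"
      using F num eq[of F] unfolding connecting_sets_def by auto
  qed
qed

text \<open>Both sides count pairs of a connecting set and an ordered edge in it. Every connecting
  set has one edge fewer than there are classes, and each edge has two orientations.\<close>

lemma connecting_sets_double_count:
  assumes "finite V" "r \<subseteq> V \<times> V"
  shows "2 * (num_classes V r - 1) * card (connecting_sets V r)
     = (\<Sum>(a, b)\<in>V \<times> V - eqcl r. card (connecting_sets V (insert (a, b) r)))"
proof -
  let ?Y = "V \<times> V - eqcl r" and ?N = "connecting_sets V r"
  have "(\<Sum>(a, b)\<in>?Y. card (connecting_sets V (insert (a, b) r)))
      = (\<Sum>(a, b)\<in>?Y. card {F \<in> ?N. {a, b} \<in> F})"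
    by (rule sum.cong) (auto simp: card_connecting_sets_containing[OF assms(1)])
  also have "\<dots> = (\<Sum>e\<in>?Y. \<Sum>F\<in>{F \<in> ?N. {fst e, snd e} \<in> F}. 1)"
    by (simp add: case_prod_unfold)
  also have "\<dots> = (\<Sum>F\<in>?N. \<Sum>e\<in>{e \<in> ?Y. {fst e, snd e} \<in> F}. 1)"
    by (rule sum.swap_restrict) (use assms finite_connecting_sets in auto)
  also have "\<dots> = (\<Sum>F\<in>?N. 2 * (num_classes V r - 1))"
  proof (rule sum.cong[OF refl])
    fix F assume F: "F \<in> ?N"
    have sub: "F \<subseteq> all_pairs V" using F by (simp add: connecting_sets_def)
    have "{e \<in> ?Y. {fst e, snd e} \<in> F} = edge_rel F"
      using connecting_sets_edge_cross[OF assms(1) F] edge_rel_sub[OF sub]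
      by (auto simp: edge_rel_def)
    then show "(\<Sum>e\<in>{e \<in> ?Y. {fst e, snd e} \<in> F}. 1) = 2 * (num_classes V r - 1)"
      using card_edge_rel[OF connecting_sets_finite[OF assms(1) F] sub] F
      by (simp add: connecting_sets_def) arith
  qed
  finally show ?thesis by simp
qed

text \<open>Two factors \<open>f\<close> and \<open>g\<close> are replaced by the single factor
  \<open>f + g = f * g * (1/f + 1/g)\<close>.\<close>

lemma prod_card_classes_insert:
  assumes "finite V" "r \<subseteq> V \<times> V" "a \<in> V" "b \<in> V" "(a, b) \<notin> eqcl r"
  shows "(\<Prod>C\<in>V // eqcl (insert (a, b) r). real (card C))
     = (\<Prod>C\<in>V // eqcl r. real (card C)) *
       (1 / real (card (eqcl r `` {a})) + 1 / real (card (eqcl r `` {b})))"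
proof -
  let ?A = "eqcl r `` {a}" and ?B = "eqcl r `` {b}" and ?Q = "V // eqcl r"
  have fin: "finite ?Q" "finite ?A" "finite ?B"
    using assms class_subset[OF assms(2)] finite_subset[OF _ assms(1)] by (auto simp: quotient_image)
  have AB: "?A \<in> ?Q" "?B \<in> ?Q" "?A \<noteq> ?B"
    using assms by (auto simp: quotient_image eqcl_class_eq)
  have disj: "?A \<inter> ?B = {}"
    using class_mem[OF AB(1)] class_mem[OF AB(2)] AB(3) by blast
  have pos: "real (card ?A) > 0" "real (card ?B) > 0" using fin by (simp_all add: card_gt_0_iff)
  have "?Q = insert ?A (insert ?B (?Q - {?A, ?B}))" using AB by auto
  then have "(\<Prod>C\<in>?Q. real (card C))
      = (\<Prod>C\<in>insert ?A (insert ?B (?Q - {?A, ?B})). real (card C))" by simp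
  also have "\<dots> = real (card ?A) * (real (card ?B) * (\<Prod>C\<in>?Q - {?A, ?B}. real (card C)))"
    using AB(3) fin by simp
  finally have 1: "(\<Prod>C\<in>?Q. real (card C))
      = real (card ?A) * (real (card ?B) * (\<Prod>C\<in>?Q - {?A, ?B}. real (card C)))" .
  have "(\<Prod>C\<in>V // eqcl (insert (a, b) r). real (card C))
      = real (card (?A \<union> ?B)) * (\<Prod>C\<in>?Q - {?A, ?B}. real (card C))"
    unfolding quotient_insert[OF assms(3,4)]
    by (rule prod.insert) (use fin merged_class_new[OF assms(5), of V] in auto)
  also have "card (?A \<union> ?B) = card ?A + card ?B" using fin disj by (simp add: card_Un_disjoint)
  finally show ?thesis unfolding 1 using pos by (simp add: field_simps)
qed

text \<open>
  Induction on the number of classes by counting pairs of a connecting set and an ordered edge in it.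
  Contracting an edge between blocks of sizes \<open>f\<close> and \<open>g\<close> multiplies the product of the block sizes
  by \<open>1/f + 1/g\<close>, and these factors sum to a multiple of \<open>card V\<close>.
\<close>
theorem card_connecting_sets:
  assumes "finite V" "V \<noteq> {}" "r \<subseteq> V \<times> V"
  shows "card V * card (connecting_sets V r)
     = card V ^ (num_classes V r - 1) * (\<Prod>C\<in>V // eqcl r. card C)"
proof -
  have "real (card V) * real (card (connecting_sets V r))
     = real (card V) ^ (num_classes V r - 1) * (\<Prod>C\<in>V // eqcl r. real (card C))"
    using assms(3)
  proof (induction "num_classes V r" arbitrary: r rule: less_induct)
    case less
    let ?p = "num_classes V r" and ?t = "real (card V)"
    have fin: "finite (V // eqcl r)" using assms by (simp add: quotient_image)
    have ne: "V // eqcl r \<noteq> {}" using assms by (simp add: quotient_image)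
    then have "?p > 0" using fin by (simp add: num_classes_def card_gt_0_iff)
    show ?case
    proof (cases "?p = 1")
      \<comment> \<open>Both sides equal \<open>card V\<close> here. The factor
        \<open>card V\<close> on the left of the statement is what admits this case: without it the
        exponent would be \<open>-1\<close>.\<close>
      case True
      have conn: "(x, y) \<in> eqcl r" if "x \<in> V" "y \<in> V" for x y
        using num_classes_le_one[OF assms(1) _ that] True by simp
      have "connecting_sets V r = {{}}"
      proof (intro equalityI subsetI)
        fix F assume F: "F \<in> connecting_sets V r"
        then show "F \<in> {{}}"
          using connecting_sets_finite[OF assms(1) F] True by (simp add: connecting_sets_def)
      qed (use True conn in \<open>auto simp: connecting_sets_def\<close>)
      moreover have "V // eqcl r = {V}"
      proof -
        have "eqcl r `` {x} = V" if "x \<in> V" for x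
          using class_subset[OF less.prems that] conn[OF that] by auto
        then show ?thesis using assms(2) unfolding quotient_image by auto
      qed
      ultimately show ?thesis using True by simp
    next
      case False
      \<comment> \<open>With \<open>q + 2\<close> classes the exponent is \<open>q + 1\<close>, and
        after contraction of an edge it is \<open>q\<close>, so no truncated subtraction
        remains.\<close>
      then obtain q where q: "?p = Suc (Suc q)"
        using \<open>?p > 0\<close> by (metis One_nat_def gr0_conv_Suc not_gr_zero)
      let ?P = "\<Prod>C\<in>V // eqcl r. real (card C)"
      have IH: "?t * real (card (connecting_sets V (insert (a, b) r)))
          = ?t ^ q * ?P * (1 / real (card (eqcl r `` {a})) + 1 / real (card (eqcl r `` {b})))"
        if "a \<in> V" "b \<in> V" "(a, b) \<notin> eqcl r" for a b
      proof -
        have "num_classes V (insert (a, b) r) = Suc q"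
          using num_classes_insert[OF assms(1) that(1,2), of r] that(3) q by simp
        then show ?thesis
          using less.hyps[of "insert (a, b) r"] less.prems that q
          by (simp add: prod_card_classes_insert[OF assms(1) less.prems that])
      qed
      have "?t * (2 * real (Suc q) * real (card (connecting_sets V r)))
          = ?t * real (2 * (?p - 1) * card (connecting_sets V r))"
        using q by (simp add: algebra_simps)
      also have "\<dots> = (\<Sum>(a, b)\<in>V \<times> V - eqcl r. ?t * real (card (connecting_sets V (insert (a, b) r))))"
        unfolding connecting_sets_double_count[OF assms(1) less.prems]
        by (simp add: sum_distrib_left case_prod_unfold)
      also have "\<dots> = (\<Sum>(a, b)\<in>V \<times> V - eqcl r. ?t ^ q * ?P *
          (1 / real (card (eqcl r `` {a})) + 1 / real (card (eqcl r `` {b}))))"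
        by (rule sum.cong) (auto simp: IH)
      also have "\<dots> = ?t ^ q * ?P * (\<Sum>(a, b)\<in>V \<times> V - eqcl r.
          1 / real (card (eqcl r `` {a})) + 1 / real (card (eqcl r `` {b})))"
        by (simp add: sum_distrib_left case_prod_unfold)
      also have "\<dots> = 2 * real (Suc q) * (?t ^ Suc q * ?P)"
        unfolding sum_inverse_class_cross[OF assms(1) less.prems] using q by (simp add: field_simps)
      finally have "2 * real (Suc q) * (?t * real (card (connecting_sets V r)))
          = 2 * real (Suc q) * (?t ^ Suc q * ?P)" by (simp add: mult_ac)
      then have "?t * real (card (connecting_sets V r)) = ?t ^ Suc q * ?P"
        by (subst (asm) mult_cancel_left) simp
      then show ?thesis using q by simp
    qed
  qed
  then have "real (card V * card (connecting_sets V r))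
     = real (card V ^ (num_classes V r - 1) * (\<Prod>C\<in>V // eqcl r. card C))" by simp
  then show ?thesis by (simp only: of_nat_eq_iff)
qed

section \<open>Junction trees as sets of links\<close>

definition containing :: "'a set set \<Rightarrow> 'a set \<Rightarrow> 'a set set" where
  "containing K s = {c \<in> K. s \<subseteq> c}"

text \<open>Loops \<open>(a, a)\<close> with \<open>s \<subset> a\<close> are included. They do not
  change the generated classes but matter when two such relations are compared as sets.\<close>

definition sep_rel :: "'a set set \<Rightarrow> 'a set \<Rightarrow> 'a set rel" where
  "sep_rel K s = {(a, b). a \<in> K \<and> b \<in> K \<and> s \<subset> a \<inter> b}"

definition num_parts :: "'a set set \<Rightarrow> 'a set \<Rightarrow> nat" where
  "num_parts K s = num_classes (containing K s) (sep_rel K s)"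

text \<open>Joining at least two blocks takes a link with separator \<open>s\<close>; hence a
  description of separators that refers to no tree.\<close>

definition family_separators :: "'a set set \<Rightarrow> 'a set set" where
  "family_separators K = {s. num_parts K s \<ge> 2}"

text \<open>The multiplicity is \<open>num_parts K s - 1\<close>, so the exponent is the
  multiplicity minus one. The factors are the block sizes.\<close>

definition family_nu :: "'a set set \<Rightarrow> 'a set \<Rightarrow> nat" where
  "family_nu K s = card (containing K s) ^ (num_parts K s - 2) *
     (\<Prod>C\<in>containing K s // eqcl (sep_rel K s). card C)"

text \<open>
  A link \<open>{a, b}\<close> is a two-element set of cliques, hence \<open>\<Inter>e\<close> is the separator of the link \<open>e\<close>.
  Acyclicity is encoded by the number of links, connectedness by the case \<open>s = {}\<close>.
\<close>
definition junction_links :: "'a set set \<Rightarrow> 'a set set set \<Rightarrow> bool" where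
  "junction_links K L \<longleftrightarrow> L \<subseteq> all_pairs K \<and> card L + 1 = card K \<and>
     (\<forall>s. \<forall>x\<in>containing K s. \<forall>y\<in>containing K s. (x, y) \<in> eqcl (edge_rel {e \<in> L. s \<subseteq> \<Inter>e}))"

lemma junction_links_sub: "junction_links K L \<Longrightarrow> L \<subseteq> all_pairs K"
  by (simp add: junction_links_def)

lemma sep_rel_sub: "sep_rel K s \<subseteq> containing K s \<times> containing K s"
  by (auto simp: sep_rel_def containing_def)

lemma finite_containing [simp]: "finite K \<Longrightarrow> finite (containing K s)"
  by (simp add: containing_def)

lemma junction_links_conn:
  assumes "junction_links K L" "x \<in> containing K s" "y \<in> containing K s"
  shows "(x, y) \<in> eqcl (edge_rel {e \<in> L. s \<subseteq> \<Inter>e})"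
  using assms unfolding junction_links_def by blast

lemma junction_links_finite: "finite K \<Longrightarrow> junction_links K L \<Longrightarrow> finite L"
  using finite_all_pairs[of K] finite_subset[of L "all_pairs K"] by (simp add: junction_links_def)

text \<open>The condition for \<open>s = {}\<close> makes all of \<open>K\<close> one component; the
  prescribed number of links then gives equality in the forest count.\<close>

lemma junction_links_forest:
  assumes "finite K" "junction_links K L" shows "forest_edges K L"
proof -
  have "K \<noteq> {}" using assms(2) by (auto simp: junction_links_def)
  then have "num_classes K (edge_rel L) = 1"
  proof (rule num_classes_one)
    show "(x, y) \<in> eqcl (edge_rel L)" if "x \<in> K" "y \<in> K" for x y
      using junction_links_conn[OF assms(2), of x "{}" y] that by (simp add: containing_def)
  qed
  then show ?thesis using assms(2) by (simp add: forest_edges_def junction_links_def)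
qed

lemma links_above_pairs:
  assumes "L \<subseteq> all_pairs K" shows "{e \<in> L. s \<subseteq> \<Inter>e} \<subseteq> all_pairs (containing K s)"
proof clarify
  fix e assume e: "e \<in> L" "s \<subseteq> \<Inter>e"
  have "e \<in> all_pairs K" using e(1) assms by (rule rev_subsetD)
  then obtain a b where ab: "e = {a, b}" "a \<in> K" "b \<in> K" "a \<noteq> b" by (rule all_pairsE)
  then have "a \<in> containing K s" "b \<in> containing K s" using e(2) by (auto simp: containing_def)
  then show "e \<in> all_pairs (containing K s)" using ab unfolding all_pairs_def by blast
qed

text \<open>A link above \<open>s\<close> is itself a pair of \<open>sep_rel K s\<close>.
  Conversely, two cliques meeting in more than \<open>s\<close> are joined by links above their
  intersection. The right-hand side is the same for every junction tree, which yields the invariance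
  of multiplicities and of \<open>nu\<close>.\<close>

lemma eqcl_strict_links:
  assumes "junction_links K L"
  shows "eqcl (edge_rel {e \<in> L. s \<subset> \<Inter>e}) = eqcl (sep_rel K s)"
proof (intro equalityI eqcl_least subrelI)
  fix a b assume "(a, b) \<in> edge_rel {e \<in> L. s \<subset> \<Inter>e}"
  then have e: "{a, b} \<in> L" "s \<subset> a \<inter> b" by (auto simp: edge_rel_def)
  then have "{a, b} \<in> all_pairs K" using assms by (auto simp: junction_links_def)
  then have "a \<in> K" "b \<in> K" by (auto simp: all_pairs_def doubleton_eq_iff)
  then show "(a, b) \<in> eqcl (sep_rel K s)" using e by (intro eqcl_base) (simp add: sep_rel_def)
next
  fix a b assume ab: "(a, b) \<in> sep_rel K s"
  then have "(a, b) \<in> eqcl (edge_rel {e \<in> L. a \<inter> b \<subseteq> \<Inter>e})"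
    by (intro junction_links_conn[OF assms]) (auto simp: sep_rel_def containing_def)
  moreover have "{e \<in> L. a \<inter> b \<subseteq> \<Inter>e} \<subseteq> {e \<in> L. s \<subset> \<Inter>e}"
    using ab by (auto simp: sep_rel_def)
  ultimately show "(a, b) \<in> eqcl (edge_rel {e \<in> L. s \<subset> \<Inter>e})"
    using eqcl_mono[OF edge_rel_mono] by blast
qed

lemma links_split:
  "{e \<in> L. s \<subseteq> \<Inter>e} = {e \<in> L. s \<subset> \<Inter>e} \<union> {e \<in> L. \<Inter>e = s}"
  by auto

text \<open>The links containing \<open>s\<close> form a spanning tree of the cliques containing
  \<open>s\<close>. Those strictly above \<open>s\<close> form a forest with the blocks as
  components, so the links with separator exactly \<open>s\<close> join the blocks and number one
  fewer than the blocks.\<close>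

lemma junction_links_connecting:
  assumes "finite K" "junction_links K L" "containing K s \<noteq> {}"
  shows "{e \<in> L. \<Inter>e = s} \<in> connecting_sets (containing K s) (sep_rel K s)"
proof -
  let ?V = "containing K s" and ?G = "{e \<in> L. s \<subseteq> \<Inter>e}" and ?H = "{e \<in> L. s \<subset> \<Inter>e}"
    and ?E = "{e \<in> L. \<Inter>e = s}"
  have L: "L \<subseteq> all_pairs K" using assms(2) by (simp add: junction_links_def)
  have fin: "finite ?V" "finite L" using assms junction_links_finite by auto
  have G: "?G \<subseteq> all_pairs ?V" by (rule links_above_pairs[OF L])
  have "?G \<subseteq> L" by auto
  have G': "forest_edges K ?G"
    by (rule forest_edges_subset[OF assms(1) junction_links_forest[OF assms(1,2)]]) auto
  \<comment> \<open>Being a bridge does not depend on the vertex set, so acyclicity passes from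
    \<open>K\<close> to the cliques containing \<open>s\<close>.\<close>
  have G'': "forest_edges ?V ?G"
    using G' unfolding forest_edges_iff[OF fin(1) G]
      forest_edges_iff[OF assms(1) subset_trans[OF \<open>?G \<subseteq> L\<close> L]] .
  have "forest_edges ?V ?H" by (rule forest_edges_subset[OF fin(1) G'']) auto
  then have H: "num_parts K s + card ?H = card ?V"
    unfolding forest_edges_def num_parts_def num_classes_def eqcl_strict_links[OF assms(2)] by simp
  have "num_classes ?V (edge_rel ?G) = 1"
    by (rule num_classes_one[OF assms(3)]) (rule junction_links_conn[OF assms(2)])
  then have "1 + card ?G = card ?V" using G'' by (simp add: forest_edges_def)
  moreover have "card ?G = card ?H + card ?E"
    unfolding links_split by (rule card_Un_disjoint) (use fin in auto)
  moreover have "eqcl (sep_rel K s \<union> edge_rel ?E) = eqcl (edge_rel ?G)"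
    unfolding links_split edge_rel_Un
    by (rule eqcl_Un_cong) (rule eqcl_strict_links[OF assms(2), symmetric])
  moreover have "?E \<subseteq> all_pairs ?V" using G by auto
  moreover have "\<forall>x\<in>?V. \<forall>y\<in>?V. (x, y) \<in> eqcl (edge_rel ?G)"
    using junction_links_conn[OF assms(2)] by blast
  ultimately show ?thesis
    using H unfolding connecting_sets_def num_parts_def by simp
qed

text \<open>If no clique contains \<open>s\<close>, there are no blocks and no links, and the
  truncated difference is \<open>0\<close> as it should be.\<close>

lemma card_links_eq_num_parts:
  assumes "finite K" "junction_links K L"
  shows "card {e \<in> L. \<Inter>e = s} = num_parts K s - 1"
proof (cases "containing K s = {}")
  case False
  have "card {e \<in> L. \<Inter>e = s} + 1 = num_parts K s"
    using junction_links_connecting[OF assms False] by (simp add: connecting_sets_def num_parts_def)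
  then show ?thesis by simp
next
  case True
  have L: "L \<subseteq> all_pairs K" using assms(2) by (simp add: junction_links_def)
  have "{e \<in> L. \<Inter>e = s} \<subseteq> all_pairs (containing K s)" using links_above_pairs[OF L, of s] by auto
  also have "\<dots> = {}" using True by (simp add: all_pairs_def)
  finally have "card {e \<in> L. \<Inter>e = s} = 0" by (simp only: subset_empty card.empty)
  moreover have "num_parts K s = 0"
    using True by (simp add: num_parts_def num_classes_def quotient_image)
  ultimately show ?thesis by simp
qed

lemma family_separators_eq:
  assumes "finite K" "junction_links K L"
  shows "family_separators K = Inter ` L"
proof -
  have "s \<in> family_separators K \<longleftrightarrow> {e \<in> L. \<Inter>e = s} \<noteq> {}" for s
  proof -
    have "finite {e \<in> L. \<Inter>e = s}" using junction_links_finite[OF assms] by simp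
    then have "{e \<in> L. \<Inter>e = s} \<noteq> {} \<longleftrightarrow> 0 < card {e \<in> L. \<Inter>e = s}" by (simp add: card_gt_0_iff)
    then show ?thesis
      unfolding card_links_eq_num_parts[OF assms] family_separators_def by auto
  qed
  moreover have "s \<in> Inter ` L \<longleftrightarrow> {e \<in> L. \<Inter>e = s} \<noteq> {}" for s by auto
  ultimately show ?thesis by (intro set_eqI) simp
qed

text \<open>Both ends contain \<open>s\<close>; if they met in more than \<open>s\<close>, the edge
  would lie inside a block.\<close>

lemma connecting_sets_link_sep:
  assumes "finite K" "F \<in> connecting_sets (containing K s) (sep_rel K s)" "e \<in> F"
  shows "\<Inter>e = s"
proof -
  have "e \<in> all_pairs (containing K s)" using assms by (auto simp: connecting_sets_def)
  then obtain a b where e: "e = {a, b}" "a \<in> containing K s" "b \<in> containing K s"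
    by (rule all_pairsE)
  have "(a, b) \<notin> eqcl (sep_rel K s)"
    by (rule connecting_sets_edge_cross[OF finite_containing[OF assms(1)] assms(2)]) (use assms(3) e in simp)
  then have "(a, b) \<notin> sep_rel K s" using eqcl_base[of a b "sep_rel K s"] by blast
  then show ?thesis using e by (auto simp: sep_rel_def containing_def)
qed

text \<open>Arbitrary choices for the individual separators fit together. The choices are pairwise
  disjoint because a link determines its separator, and their sizes agree with those in
  \<open>L0\<close>, which gives the total number of links. Connectivity above \<open>s\<close>
  follows from connectivity above all larger sets, since the choice for \<open>s\<close> then joins
  the blocks.\<close>

lemma junction_links_Union:
  assumes fin: "finite K" "finite (\<Union>K)" and L0: "junction_links K L0"
    and f: "\<And>s. s \<in> family_separators K \<Longrightarrow> f s \<in> connecting_sets (containing K s) (sep_rel K s)"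
  shows "junction_links K (\<Union>s\<in>family_separators K. f s)"
proof -
  let ?S = "family_separators K"
  let ?L = "\<Union>s\<in>?S. f s"
  have sep: "\<Inter>e = s" if "s \<in> ?S" "e \<in> f s" for s e
    using connecting_sets_link_sep[OF fin(1) f] that by blast
  have finS: "finite ?S"
    unfolding family_separators_eq[OF fin(1) L0] using junction_links_finite[OF fin(1) L0] by simp
  have "f s \<subseteq> all_pairs K" if "s \<in> ?S" for s
  proof -
    have "f s \<subseteq> all_pairs (containing K s)" using f[OF that] by (simp add: connecting_sets_def)
    also have "\<dots> \<subseteq> all_pairs K" by (auto simp: all_pairs_def containing_def)
    finally show ?thesis .
  qed
  then have sub: "?L \<subseteq> all_pairs K" by blast
  have card_f: "card (f s) = card {e \<in> L0. \<Inter>e = s}" if "s \<in> ?S" for s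
  proof -
    have "card (f s) + 1 = num_parts K s"
      using f[OF that] by (simp add: connecting_sets_def num_parts_def)
    then show ?thesis unfolding card_links_eq_num_parts[OF fin(1) L0] by simp
  qed
  have "card ?L = (\<Sum>s\<in>?S. card (f s))"
  proof (rule card_UN_disjoint[OF finS])
    show "\<forall>s\<in>?S. finite (f s)"
      using f connecting_sets_finite[OF finite_containing[OF fin(1)]] by blast
    show "\<forall>s\<in>?S. \<forall>s'\<in>?S. s \<noteq> s' \<longrightarrow> f s \<inter> f s' = {}" using sep by blast
  qed
  also have "\<dots> = (\<Sum>s\<in>?S. card {e \<in> L0. \<Inter>e = s})" by (rule sum.cong) (auto simp: card_f)
  also have "\<dots> = card L0"
    unfolding family_separators_eq[OF fin(1) L0]
    using sum.image_gen[OF junction_links_finite[OF fin(1) L0], of "\<lambda>_. 1::nat" Inter] by simp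
  finally have card: "card ?L + 1 = card K" using L0 by (simp add: junction_links_def)
  have conn: "(x, y) \<in> eqcl (edge_rel {e \<in> ?L. s \<subseteq> \<Inter>e})"
    if "x \<in> containing K s" "y \<in> containing K s" for x y s
    using that
  \<comment> \<open>The induction descends from large \<open>s\<close> to small ones; the measure
    drops when \<open>s\<close> is replaced by a larger intersection of two cliques.\<close>
  proof (induction "card (\<Union>K - s)" arbitrary: s x y rule: less_induct)
    case less
    let ?G = "{e \<in> ?L. s \<subseteq> \<Inter>e}"
    have rel: "(a, b) \<in> eqcl (edge_rel ?G)" if ab: "(a, b) \<in> sep_rel K s" for a b
    proof -
      have "(a, b) \<in> eqcl (edge_rel {e \<in> ?L. a \<inter> b \<subseteq> \<Inter>e})"
      proof (rule less.hyps)
        have "\<Union>K - a \<inter> b \<subset> \<Union>K - s" using ab by (auto simp: sep_rel_def)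
        then show "card (\<Union>K - a \<inter> b) < card (\<Union>K - s)" using fin(2) by (simp add: psubset_card_mono)
      qed (use ab in \<open>auto simp: sep_rel_def containing_def\<close>)
      moreover have "{e \<in> ?L. a \<inter> b \<subseteq> \<Inter>e} \<subseteq> ?G" using ab by (auto simp: sep_rel_def)
      ultimately show ?thesis using eqcl_mono[OF edge_rel_mono] by blast
    qed
    show ?case
    proof (cases "s \<in> ?S")
      case True
      have "(x, y) \<in> eqcl (sep_rel K s \<union> edge_rel (f s))"
        using f[OF True] less.prems by (simp add: connecting_sets_def)
      moreover have "f s \<subseteq> ?G" using sep[OF True] True by blast
      then have "edge_rel (f s) \<subseteq> edge_rel ?G" by (rule edge_rel_mono)
      then have "edge_rel (f s) \<subseteq> eqcl (edge_rel ?G)" by (auto intro: eqcl_base)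
      then have "sep_rel K s \<union> edge_rel (f s) \<subseteq> eqcl (edge_rel ?G)" using rel by auto
      ultimately show ?thesis using eqcl_least by blast
    next
      \<comment> \<open>A set that is not a separator has at most one block, so pairs in
        \<open>sep_rel K s\<close> already connect \<open>x\<close> and \<open>y\<close>.\<close>
      case False
      then have "(x, y) \<in> eqcl (sep_rel K s)"
        using num_classes_le_one[OF finite_containing[OF fin(1)] _ less.prems]
        by (simp add: family_separators_def num_parts_def)
      moreover have "sep_rel K s \<subseteq> eqcl (edge_rel ?G)" by (intro subrelI) (rule rel)
      ultimately show ?thesis using eqcl_least by blast
    qed
  qed
  show ?thesis unfolding junction_links_def using sub card conn by blast
qed

text \<open>With at least two blocks the factor \<open>card (containing K s)\<close> can be split
  off the power in \<open>card_connecting_sets\<close> and cancelled.\<close>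

lemma card_connecting_sets_family:
  assumes "finite K" "s \<in> family_separators K"
  shows "card (connecting_sets (containing K s) (sep_rel K s)) = family_nu K s"
proof -
  have p: "num_parts K s \<ge> 2" using assms by (simp add: family_separators_def)
  have ne: "containing K s \<noteq> {}"
  proof
    assume "containing K s = {}"
    then show False using p by (simp add: num_parts_def num_classes_def quotient_image)
  qed
  have "card (containing K s) ^ (num_parts K s - 1) = card (containing K s) * card (containing K s) ^ (num_parts K s - 2)"
    using p by (metis Suc_1 Suc_diff_le diff_Suc_Suc numeral_2_eq_2 power_Suc One_nat_def)
  then have "card (containing K s) * card (connecting_sets (containing K s) (sep_rel K s))
      = card (containing K s) * family_nu K s"
    using card_connecting_sets[OF finite_containing[OF assms(1)] ne sep_rel_sub]
    by (simp only: family_nu_def num_parts_def mult.assoc)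
  moreover have "card (containing K s) \<noteq> 0" using ne assms(1) by simp
  ultimately show ?thesis by simp
qed

lemma finite_family_separators: "finite K \<Longrightarrow> junction_links K L \<Longrightarrow> finite (family_separators K)"
  by (simp add: family_separators_eq junction_links_finite)

text \<open>Sorting the links by separator is a bijection from junction trees to families of
  independent choices, one connecting set per separator; its inverse takes the union.\<close>

theorem card_junction_links:
  assumes fin: "finite K" "finite (\<Union>K)" and L0: "junction_links K L0"
  shows "card {L. junction_links K L} = (\<Prod>s\<in>family_separators K. family_nu K s)"
proof -
  let ?S = "family_separators K" and ?C = "\<lambda>s. connecting_sets (containing K s) (sep_rel K s)"
  have "bij_betw (\<lambda>L. \<lambda>s\<in>?S. {e \<in> L. \<Inter>e = s}) {L. junction_links K L} (PiE ?S ?C)"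
  proof (rule bij_betw_byWitness[where f' = "\<lambda>f. \<Union>s\<in>?S. f s"])
    show "\<forall>L\<in>{L. junction_links K L}. (\<Union>s\<in>?S. (\<lambda>s\<in>?S. {e \<in> L. \<Inter>e = s}) s) = L"
      using family_separators_eq[OF fin(1)] by auto
    show "\<forall>f\<in>PiE ?S ?C. (\<lambda>s\<in>?S. {e \<in> (\<Union>s\<in>?S. f s). \<Inter>e = s}) = f"
    proof
      fix f assume f: "f \<in> PiE ?S ?C"
      have "\<Inter>e = s" if "s \<in> ?S" "e \<in> f s" for s e
        using connecting_sets_link_sep[OF fin(1) PiE_mem[OF f that(1)] that(2)] .
      then have "{e \<in> (\<Union>s\<in>?S. f s). \<Inter>e = s} = f s" if "s \<in> ?S" for s
        using that by blast
      then show "(\<lambda>s\<in>?S. {e \<in> (\<Union>s\<in>?S. f s). \<Inter>e = s}) = f"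
        using PiE_arb[OF f] by (simp add: restrict_def fun_eq_iff)
    qed
    show "(\<lambda>L. \<lambda>s\<in>?S. {e \<in> L. \<Inter>e = s}) ` {L. junction_links K L} \<subseteq> PiE ?S ?C"
    proof clarify
      fix L assume L: "junction_links K L"
      show "(\<lambda>s\<in>?S. {e \<in> L. \<Inter>e = s}) \<in> PiE ?S ?C"
      proof (rule restrict_PiE_iff[THEN iffD2], rule ballI)
        fix s assume "s \<in> ?S"
        then have "containing K s \<noteq> {}"
          by (auto simp: family_separators_def num_parts_def num_classes_def quotient_image)
        then show "{e \<in> L. \<Inter>e = s} \<in> ?C s" by (rule junction_links_connecting[OF fin(1) L])
      qed
    qed
    show "(\<lambda>f. \<Union>s\<in>?S. f s) ` PiE ?S ?C \<subseteq> {L. junction_links K L}"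
    proof clarify
      fix f assume f: "f \<in> PiE ?S ?C"
      show "junction_links K (\<Union>s\<in>?S. f s)"
        by (rule junction_links_Union[OF fin L0]) (rule PiE_mem[OF f])
    qed
  qed
  then have "card {L. junction_links K L} = card (PiE ?S ?C)" by (rule bij_betw_same_card)
  also have "\<dots> = (\<Prod>s\<in>?S. card (?C s))"
    by (rule card_PiE) (rule finite_family_separators[OF fin(1) L0])
  also have "\<dots> = (\<Prod>s\<in>?S. family_nu K s)"
    by (rule prod.cong) (simp_all add: card_connecting_sets_family fin)
  finally show ?thesis .
qed

section \<open>Junction trees as digraphs\<close>

lemma eqcl_sym_rel:
  assumes "sym r" shows "eqcl r = r\<^sup>*"
proof -
  have "r \<union> r\<inverse> = r" using assms by (simp add: sym_conv_converse_eq)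
  then show ?thesis by (simp add: eqcl_def)
qed

lemma sym_edge_rel: "sym (edge_rel L)"
  by (auto simp: edge_rel_def insert_commute intro: symI)

text \<open>Symmetry makes directed reachability undirected. Membership in \<open>verts H\<close> is
  stated separately because \<open>eqcl\<close> relates every point of the type to itself.\<close>

lemma reachable_iff_eqcl:
  assumes "wf_digraph H" "sym (arcs_ends H)"
  shows "u \<rightarrow>\<^sup>*\<^bsub>H\<^esub> v \<longleftrightarrow> u \<in> verts H \<and> v \<in> verts H \<and> (u, v) \<in> eqcl (arcs_ends H)"
proof -
  interpret wf_digraph H by fact
  show ?thesis
    unfolding eqcl_sym_rel[OF assms(2)]
    by (meson adj_in_verts reachable_def reachable_in_vertsE reachable_rtranclI
        rtrancl_consistent_rtrancl_on)
qed

lemma sccs_verts_eq: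
  assumes "wf_digraph H" "sym (arcs_ends H)"
  shows "pre_digraph.sccs_verts H = verts H // eqcl (arcs_ends H)"
proof -
  interpret wf_digraph H by fact
  let ?r = "arcs_ends H"
  note reach = reachable_iff_eqcl[OF assms]
  have sub: "?r \<subseteq> verts H \<times> verts H" using adj_in_verts by auto
  show ?thesis
  proof (intro equalityI subsetI)
    fix S assume "S \<in> sccs_verts"
    then have S: "S \<noteq> {}" "\<And>u v. u \<in> S \<Longrightarrow> v \<in> S \<Longrightarrow> u \<rightarrow>\<^sup>*\<^bsub>H\<^esub> v"
      "\<And>u v. u \<in> S \<Longrightarrow> v \<notin> S \<Longrightarrow> \<not> u \<rightarrow>\<^sup>*\<^bsub>H\<^esub> v \<or> \<not> v \<rightarrow>\<^sup>*\<^bsub>H\<^esub> u"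
      by (auto simp: sccs_verts_def)
    obtain u where u: "u \<in> S" using S(1) by blast
    then have uV: "u \<in> verts H" using S(2)[OF u u] reach by blast
    have "S = eqcl ?r `` {u}"
    proof (intro equalityI subsetI)
      fix v assume "v \<in> S" then show "v \<in> eqcl ?r `` {u}" using S(2)[OF u] reach by blast
    next
      fix v assume v: "v \<in> eqcl ?r `` {u}"
      then have "v \<in> verts H" using class_subset[OF sub uV] by blast
      then have "u \<rightarrow>\<^sup>*\<^bsub>H\<^esub> v" "v \<rightarrow>\<^sup>*\<^bsub>H\<^esub> u" using v uV eqcl_sym[of u v ?r] by (simp_all add: reach)
      then show "v \<in> S" using S(3)[OF u] by blast
    qed
    then show "S \<in> verts H // eqcl ?r" using uV by (simp add: quotient_image)
  next
    fix S assume "S \<in> verts H // eqcl ?r"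
    then obtain u where u: "u \<in> verts H" "S = eqcl ?r `` {u}" by (auto simp: quotient_image)
    have SV: "S \<subseteq> verts H" using class_subset[OF sub u(1)] u(2) by simp
    have conn: "(v, w) \<in> eqcl ?r \<longleftrightarrow> w \<in> S" if "v \<in> S" for v w
      using that u(2) eqcl_cong(2)[of u v ?r w] by simp
    show "S \<in> sccs_verts"
    proof -
      have "v \<rightarrow>\<^sup>*\<^bsub>H\<^esub> w \<longleftrightarrow> w \<in> S" if "v \<in> S" for v w
        using conn[OF that] SV that unfolding reach by blast
      moreover have "S \<noteq> {}" unfolding u(2) by simp
      ultimately show ?thesis unfolding sccs_verts_def by blast
    qed
  qed
qed

section \<open>Symmetric digraphs and their sets of undirected links\<close>

definition link_graph :: "'b set \<Rightarrow> 'b set set \<Rightarrow> 'b pair_pre_digraph" where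
  "link_graph K L = \<lparr>pverts = K, parcs = edge_rel L\<rparr>"

lemma link_graph_simps [simp]: "pverts (link_graph K L) = K" "parcs (link_graph K L) = edge_rel L"
  by (simp_all add: link_graph_def)

lemma pair_graph_link_graph:
  assumes "finite K" "L \<subseteq> all_pairs K" shows "pair_graph (link_graph K L)"
proof -
  have sub: "edge_rel L \<subseteq> K \<times> K" by (rule edge_rel_sub[OF assms(2)])
  then have "finite (edge_rel L)" using assms(1) finite_subset by blast
  moreover have "fst e \<noteq> snd e" if e: "e \<in> edge_rel L" for e
  proof
    assume "fst e = snd e"
    then have "{fst e} \<in> L" using e by (auto simp: edge_rel_def)
    then have "{fst e} \<in> all_pairs K" using assms(2) by blast
    then show False by (auto simp: all_pairs_def)
  qed
  ultimately show ?thesis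
    using assms(1) sub sym_edge_rel[of L]
    by unfold_locales (auto simp: symmetric_def)
qed

lemma pair_graph_eq_link_graph:
  assumes "pair_graph T"
  obtains L where "L \<subseteq> all_pairs (pverts T)" "T = link_graph (pverts T) L"
proof
  interpret T: pair_graph T by fact
  let ?L = "{{a, b} | a b. (a, b) \<in> parcs T}"
  show "?L \<subseteq> all_pairs (pverts T)"
  proof clarify
    fix a b assume e: "(a, b) \<in> parcs T"
    then have "a \<in> pverts T" "b \<in> pverts T" "a \<noteq> b"
      using T.in_arcsD1 T.in_arcsD2 T.no_loops' by auto
    then show "{a, b} \<in> all_pairs (pverts T)" by (auto simp: all_pairs_def)
  qed
  have "edge_rel ?L = parcs T"
    using T.arcs_symmetric by (auto simp: edge_rel_def doubleton_eq_iff)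
  then show "T = link_graph (pverts T) ?L" by (simp add: link_graph_def)
qed

text \<open>In general \<open>edge_rel\<close> forgets members of \<open>L\<close> that are not of
  the form \<open>{a, b}\<close>; within \<open>all_pairs\<close> nothing is lost, so counting trees
  amounts to counting link sets.\<close>

lemma link_graph_inj:
  assumes "L \<subseteq> all_pairs K" "L' \<subseteq> all_pairs K'" "link_graph K L = link_graph K' L'"
  shows "L = L'"
proof -
  have eq: "edge_rel L = edge_rel L'" using assms(3) by (simp add: link_graph_def)
  have "e \<in> M'" if "M \<subseteq> all_pairs K''" "edge_rel M = edge_rel M'" "e \<in> M"
    for e M M' and K'' :: "'a set"
  proof -
    have "e \<in> all_pairs K''" using that by blast
    then obtain a b where ab: "e = {a, b}" by (rule all_pairsE)
    have "(a, b) \<in> edge_rel M" using that(3) unfolding ab by (simp add: edge_rel_def)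
    then have "(a, b) \<in> edge_rel M'" using that(2) by simp
    then show ?thesis using ab by (simp add: edge_rel_def)
  qed
  then show ?thesis using assms eq by blast
qed

lemma connected_link_graph:
  assumes "finite K" "L \<subseteq> all_pairs K"
  shows "connected (with_proj (link_graph K L)) \<longleftrightarrow>
    K \<noteq> {} \<and> (\<forall>x\<in>K. \<forall>y\<in>K. (x, y) \<in> eqcl (edge_rel L))"
proof -
  let ?T = "link_graph K L"
  interpret T: pair_graph ?T by (rule pair_graph_link_graph[OF assms])
  \<comment> \<open>The arcs are already symmetric, so the symmetrization inside
    \<open>connected\<close> changes nothing.\<close>
  have "(\<Union>e\<in>edge_rel L. {(fst e, snd e), (snd e, fst e)}) = edge_rel L"
    using sym_edge_rel[of L] by (auto dest: symD)
  then have "mk_symmetric (with_proj ?T) = ?T"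
    by (simp add: mk_symmetric_def link_graph_def with_proj_def)
  moreover have "u \<rightarrow>\<^sup>*\<^bsub>with_proj ?T\<^esub> v \<longleftrightarrow> u \<in> K \<and> v \<in> K \<and> (u, v) \<in> eqcl (edge_rel L)" for u v
    using reachable_iff_eqcl[OF T.wf_digraph_axioms, of u v] sym_edge_rel[of L] by simp
  ultimately show ?thesis by (auto simp: connected_def strongly_connected_def)
qed

lemma pcas_eqcl:
  assumes "pcas u p v" "\<And>e. e \<in> set p \<Longrightarrow> e \<in> r" shows "(u, v) \<in> eqcl r"
  using assms
proof (induction p arbitrary: u)
  case Nil then show ?case by simp
next
  case (Cons e p)
  have "(u, snd e) \<in> r" using Cons.prems by (cases e) auto
  moreover have "(snd e, v) \<in> eqcl r" using Cons by auto
  ultimately show ?case using eqcl_base eqcl_trans by metis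
qed

lemma last_in_pawalk_verts: "pcas u p v \<Longrightarrow> v \<in> set (pawalk_verts u p)"
  by (induction p arbitrary: u) auto

lemma set_pawalk_verts: "e \<in> set p \<Longrightarrow> pcas u p v \<Longrightarrow> fst e \<in> set (pawalk_verts u p) \<and> snd e \<in> set (pawalk_verts u p)"
proof (induction p arbitrary: u)
  case (Cons d p)
  have "snd d \<in> set (pawalk_verts (snd d) p)" by (cases p) (use Cons.prems in auto)
  then show ?case using Cons by auto
qed simp

text \<open>Via the bridge criterion: the remainder of a cycle of length at least 3 connects the
  ends of one of its edges; conversely, a path between the ends of an edge that avoids this edge is
  closed by it to a cycle.\<close>

lemma acyclic_link_graph:
  assumes "finite K" "L \<subseteq> all_pairs K"
  shows "\<not> (\<exists>p. pre_digraph.cycle (with_proj (link_graph K L)) p \<and> length p \<ge> 3) \<longleftrightarrow>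
    forest_edges K L"
proof -
  let ?T = "link_graph K L"
  interpret T: pair_graph ?T by (rule pair_graph_link_graph[OF assms])
  have sub: "edge_rel L \<subseteq> K \<times> K" by (rule edge_rel_sub[OF assms(2)])
  have 1: "\<exists>a b. {a, b} \<in> L \<and> (a, b) \<in> eqcl (edge_rel (L - {{a, b}}))"
    if p: "T.cycle p" "length p \<ge> 3" for p
  proof -
    obtain u where u: "T.awalk u p u" "distinct (tl (pawalk_verts u p))"
      using p(1) by (auto simp: T.cycle_def)
    \<comment> \<open>The second arc \<open>(b, c)\<close> is the one removed: \<open>b\<close> does
      not occur in the rest \<open>q\<close>, so no arc of \<open>q\<close> runs along this edge. A
      third arc is needed to get \<open>u \<noteq> c\<close>, which separates the first arc from
      it.\<close>
    obtain e1 e2 q where q: "p = e1 # e2 # q" "q \<noteq> []"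
    proof -
      obtain e1 e2 e3 q' where "p = e1 # e2 # e3 # q'"
        using p(2) by (auto simp: numeral_3_eq_3 Suc_le_length_iff)
      then show ?thesis using that by simp
    qed
    obtain b c where e: "e1 = (u, b)" "e2 = (b, c)"
      using u(1) q by (cases e1; cases e2) (auto simp: T.awalk_def)
    have w: "pcas c q u" "set q \<subseteq> edge_rel L" "(u, b) \<in> edge_rel L" "(b, c) \<in> edge_rel L"
      using u(1) q e by (auto simp: T.awalk_def)
    have d: "b \<notin> set (pawalk_verts c q)" "distinct (pawalk_verts c q)"
      using u(2) q(1) e by auto
    have "u \<noteq> c"
    proof -
      obtain f q' where f: "q = f # q'" using q(2) by (cases q) auto
      then have "u \<in> set (pawalk_verts (snd f) q')" using w(1) last_in_pawalk_verts by auto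
      then show ?thesis using d(2) w(1) f by auto
    qed
    have "(u, b) \<in> edge_rel (L - {{b, c}})"
      using w(3,4) \<open>u \<noteq> c\<close> by (auto simp: edge_rel_def doubleton_eq_iff)
    moreover have "(c, u) \<in> eqcl (edge_rel (L - {{b, c}}))"
    proof (rule pcas_eqcl[OF w(1)])
      fix f assume f: "f \<in> set q"
      then have "b \<noteq> fst f" "b \<noteq> snd f" using set_pawalk_verts[OF f w(1)] d(1) by auto
      then show "f \<in> edge_rel (L - {{b, c}})"
        using f w(2) by (cases f) (auto simp: edge_rel_def doubleton_eq_iff)
    qed
    ultimately have "(b, c) \<in> eqcl (edge_rel (L - {{b, c}}))"
      using eqcl_base eqcl_sym eqcl_trans by metis
    then show ?thesis using w(4) by (auto simp: edge_rel_def)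
  qed
  have 2: "\<exists>p. T.cycle p \<and> length p \<ge> 3"
    if ab: "{a, b} \<in> L" "(a, b) \<in> eqcl (edge_rel (L - {{a, b}}))" for a b
  proof -
    let ?L' = "L - {{a, b}}"
    have L': "?L' \<subseteq> all_pairs K" using assms(2) by auto
    interpret T': pair_graph "link_graph K ?L'" by (rule pair_graph_link_graph[OF assms(1) L'])
    have e: "(b, a) \<in> edge_rel L" using ab(1) by (simp add: edge_rel_def insert_commute)
    then have ends: "a \<in> K" "b \<in> K" "a \<noteq> b" using sub T.no_loops'[of b a] by auto
    then have "a \<rightarrow>\<^sup>*\<^bsub>with_proj (link_graph K ?L')\<^esub> b"
      using reachable_iff_eqcl[OF T'.wf_digraph_axioms, of a b] sym_edge_rel[of ?L'] ab(2) by simp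
    then obtain p0 where "T'.awalk a p0 b" using T'.reachable_awalk by blast
    then obtain p where p: "T'.apath a p b" using T'.apath_awalk_to_apath by blast
    then have w: "pcas a p b" "set p \<subseteq> edge_rel ?L'" "distinct (pawalk_verts a p)"
      by (auto simp: T'.apath_def T'.awalk_def)
    have "p \<noteq> []" using w(1) ends(3) by auto
    moreover have "length p \<noteq> 1"
    \<comment> \<open>A path of length one from \<open>a\<close> to \<open>b\<close> would use the
      edge that was deleted.\<close>
    proof
      assume "length p = 1"
      then have "p = [(a, b)]" using w(1) by (cases p) auto
      then show False using w(2) by (auto simp: edge_rel_def)
    qed
    ultimately have "length p \<ge> 2" by (cases p) (auto simp: Suc_le_eq)
    moreover have "T.awalk b ((b, a) # p) b"
      unfolding T.awalk_def using w edge_rel_mono[of ?L' L] e ends by auto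
    then have "T.cycle ((b, a) # p)" unfolding T.cycle_def using w(3) by auto
    ultimately show ?thesis by (intro exI[of _ "(b, a) # p"]) simp
  qed
  show ?thesis unfolding forest_edges_iff[OF assms] using 1 2 by blast
qed

lemma vwalk_arcs_eqcl:
  assumes "set (vwalk_arcs p) \<subseteq> r" "p \<noteq> []" shows "(hd p, last p) \<in> eqcl r"
  using assms
proof (induction p rule: vwalk_arcs.induct)
  case (3 x y xs)
  then have "(x, y) \<in> eqcl r" "(y, last (y # xs)) \<in> eqcl r" by (auto intro: eqcl_base)
  then show ?case using eqcl_trans by fastforce
qed auto

text \<open>From left to right, every node on the path from \<open>x\<close> to \<open>y\<close>
  contains \<open>x \<inter> y\<close> and hence \<open>s\<close>, so the path consists of links
  above \<open>s\<close>. From right to left, a path step not above the intersection of the path's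
  ends could be bypassed by links that are, contradicting that it is a bridge.\<close>

lemma vpath_property_link_graph:
  assumes "finite K" "L \<subseteq> all_pairs K" "forest_edges K L"
    and conn: "\<And>x y. x \<in> K \<Longrightarrow> y \<in> K \<Longrightarrow> (x, y) \<in> eqcl (edge_rel L)"
  shows "(\<forall>p. vpath p (with_proj (link_graph K L)) \<longrightarrow> (\<forall>d\<in>set p. hd p \<inter> last p \<subseteq> d)) \<longleftrightarrow>
    (\<forall>s. \<forall>x\<in>containing K s. \<forall>y\<in>containing K s. (x, y) \<in> eqcl (edge_rel {e \<in> L. s \<subseteq> \<Inter>e}))"
    (is "?P \<longleftrightarrow> ?Q")
proof
  let ?T = "link_graph K L"
  interpret T: pair_graph ?T by (rule pair_graph_link_graph[OF assms(1,2)])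
  assume P: ?P
  show ?Q
  proof (intro allI ballI)
    fix s x y assume x: "x \<in> containing K s" and y: "y \<in> containing K s"
    then have "x \<in> K" "y \<in> K" by (auto simp: containing_def)
    then have "x \<rightarrow>\<^sup>*\<^bsub>with_proj ?T\<^esub> y"
      using reachable_iff_eqcl[OF T.wf_digraph_axioms, of x y] sym_edge_rel[of L] conn by simp
    then obtain p where p: "vpath p (with_proj ?T)" "hd p = x" "last p = y"
      using T.reachable_vpath_conv by blast
    have ps: "s \<subseteq> d" if "d \<in> set p" for d
    proof -
      have "x \<inter> y \<subseteq> d" using P p that by blast
      then show ?thesis using x y by (auto simp: containing_def)
    qed
    have "set (vwalk_arcs p) \<subseteq> edge_rel {e \<in> L. s \<subseteq> \<Inter>e}"
    proof (rule subrelI)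
      fix a b assume ab: "(a, b) \<in> set (vwalk_arcs p)"
      then have "a \<in> set p" "b \<in> set p" using in_set_vwalk_arcsE by metis+
      moreover have "(a, b) \<in> edge_rel L" using ab p(1) by (auto simp: vpath_def vwalk_def)
      ultimately show "(a, b) \<in> edge_rel {e \<in> L. s \<subseteq> \<Inter>e}"
        using ps by (auto simp: edge_rel_def)
    qed
    moreover have "p \<noteq> []" using p(1) by (auto simp: vpath_def vwalk_def)
    ultimately show "(x, y) \<in> eqcl (edge_rel {e \<in> L. s \<subseteq> \<Inter>e})"
      using vwalk_arcs_eqcl p(2,3) by blast
  qed
next
  let ?T = "link_graph K L"
  assume Q: ?Q
  show ?P
  proof (intro allI impI ballI)
    fix p d assume p: "vpath p (with_proj ?T)" and d: "d \<in> set p"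
    let ?s = "hd p \<inter> last p"
    have pn: "p \<noteq> []" "set p \<subseteq> K" "set (vwalk_arcs p) \<subseteq> edge_rel L" "distinct p"
      using p by (auto simp: vpath_def vwalk_def)
    have ends: "(hd p, last p) \<in> eqcl (edge_rel {e \<in> L. ?s \<subseteq> \<Inter>e})"
    proof -
      have "hd p \<in> K" "last p \<in> K" using pn hd_in_set last_in_set by blast+
      then show ?thesis by (intro Q[rule_format]) (auto simp: containing_def)
    qed
    have step: "?s \<subseteq> u \<inter> v" if uv: "p = p1 @ u # v # p2" for p1 u v p2
    proof (rule ccontr)
      assume ns: "\<not> ?s \<subseteq> u \<inter> v"
      let ?M = "L - {{u, v}}"
      have split: "p = (p1 @ [u]) @ (v # p2)" using uv by simp
      have arcs: "vwalk_arcs p = vwalk_arcs (p1 @ [u]) @ (u, v) # vwalk_arcs (v # p2)"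
        unfolding split by (subst vwalk_arcs_append) auto
      have "set (vwalk_arcs (p1 @ [u])) \<subseteq> edge_rel ?M"
      proof (rule subrelI)
        fix a b assume ab: "(a, b) \<in> set (vwalk_arcs (p1 @ [u]))"
        then have "a \<in> set (p1 @ [u])" "b \<in> set (p1 @ [u])" using in_set_vwalk_arcsE by metis+
        then have "a \<noteq> v" "b \<noteq> v" using pn(4) uv by auto
        then show "(a, b) \<in> edge_rel ?M"
          using ab pn(3) arcs by (auto simp: edge_rel_def doubleton_eq_iff)
      qed
      then have 1: "(hd p, u) \<in> eqcl (edge_rel ?M)"
        using vwalk_arcs_eqcl[of "p1 @ [u]" "edge_rel ?M"] uv by (cases p1) auto
      have "set (vwalk_arcs (v # p2)) \<subseteq> edge_rel ?M"
      proof (rule subrelI)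
        fix a b assume ab: "(a, b) \<in> set (vwalk_arcs (v # p2))"
        then have "a \<in> set (v # p2)" "b \<in> set (v # p2)" using in_set_vwalk_arcsE by metis+
        then have "a \<noteq> u" "b \<noteq> u" using pn(4) uv by auto
        then show "(a, b) \<in> edge_rel ?M"
          using ab pn(3) arcs by (auto simp: edge_rel_def doubleton_eq_iff)
      qed
      then have 2: "(v, last p) \<in> eqcl (edge_rel ?M)"
        using vwalk_arcs_eqcl[of "v # p2" "edge_rel ?M"] uv by auto
      have "{e \<in> L. ?s \<subseteq> \<Inter>e} \<subseteq> ?M" using ns by auto
      then have 3: "(hd p, last p) \<in> eqcl (edge_rel ?M)"
        by (rule subsetD[OF eqcl_mono[OF edge_rel_mono] ends])
      have "(u, v) \<in> eqcl (edge_rel ?M)"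
        by (rule eqcl_trans[OF eqcl_sym[OF 1] eqcl_trans[OF 3 eqcl_sym[OF 2]]])
      moreover have "{u, v} \<in> L" using pn(3) arcs by (auto simp: edge_rel_def)
      ultimately show False using assms(3) unfolding forest_edges_iff[OF assms(1,2)] by blast
    qed
    obtain p1 p2 where dp: "p = p1 @ d # p2" using d by (metis split_list)
    show "?s \<subseteq> d"
    \<comment> \<open>The last node contains the intersection trivially; any other node is an end of
      the step that leaves it.\<close>
    proof (cases p2)
      case Nil then show ?thesis using dp by auto
    next
      case (Cons v p3) then show ?thesis using step[of p1 d v p3] dp by auto
    qed
  qed
qed

lemma junction_tree_link_graph:
  assumes "finite (cliques G)" "L \<subseteq> all_pairs (cliques G)"
  shows "junction_tree G (link_graph (cliques G) L) \<longleftrightarrow> junction_links (cliques G) L"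
proof -
  let ?K = "cliques G"
  have f: "junction_links ?K L \<Longrightarrow> forest_edges ?K L" by (rule junction_links_forest[OF assms(1)])
  have c: "(x, y) \<in> eqcl (edge_rel L)" if "junction_links ?K L" "x \<in> ?K" "y \<in> ?K" for x y
    using junction_links_conn[OF that(1), of x "{}" y] that by (simp add: containing_def)
  have n: "junction_links ?K L \<Longrightarrow> ?K \<noteq> {}" by (auto simp: junction_links_def)
  \<comment> \<open>A connected forest has one component, which turns the forest equation into the
    number of links.\<close>
  have d: "card L + 1 = card ?K"
    if "forest_edges ?K L" "?K \<noteq> {}" "\<forall>x\<in>?K. \<forall>y\<in>?K. (x, y) \<in> eqcl (edge_rel L)"
    using that num_classes_one[of ?K "edge_rel L"] by (simp add: forest_edges_def)
  have "junction_tree G (link_graph ?K L) \<longleftrightarrow>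
      (?K \<noteq> {} \<and> (\<forall>x\<in>?K. \<forall>y\<in>?K. (x, y) \<in> eqcl (edge_rel L))) \<and> forest_edges ?K L \<and>
      (\<forall>p. vpath p (with_proj (link_graph ?K L)) \<longrightarrow> (\<forall>d\<in>set p. hd p \<inter> last p \<subseteq> d))"
    unfolding junction_tree_def undirected_tree_def connected_link_graph[OF assms]
      acyclic_link_graph[OF assms]
    using pair_graph_link_graph[OF assms] by auto
  also have "\<dots> \<longleftrightarrow> junction_links ?K L"
  proof
    assume "junction_links ?K L"
    then show "(?K \<noteq> {} \<and> (\<forall>x\<in>?K. \<forall>y\<in>?K. (x, y) \<in> eqcl (edge_rel L))) \<and> forest_edges ?K L \<and>
      (\<forall>p. vpath p (with_proj (link_graph ?K L)) \<longrightarrow> (\<forall>d\<in>set p. hd p \<inter> last p \<subseteq> d))"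
      using f c n vpath_property_link_graph[OF assms] by (simp add: junction_links_def)
  next
    assume "(?K \<noteq> {} \<and> (\<forall>x\<in>?K. \<forall>y\<in>?K. (x, y) \<in> eqcl (edge_rel L))) \<and> forest_edges ?K L \<and>
      (\<forall>p. vpath p (with_proj (link_graph ?K L)) \<longrightarrow> (\<forall>d\<in>set p. hd p \<inter> last p \<subseteq> d))"
    then show "junction_links ?K L"
      using d vpath_property_link_graph[OF assms] assms(2) by (simp add: junction_links_def)
  qed
  finally show ?thesis .
qed

lemma junction_trees_eq:
  assumes "finite (cliques G)"
  shows "{T. junction_tree G T} = link_graph (cliques G) ` {L. junction_links (cliques G) L}"
proof (intro equalityI subsetI)
  fix T assume "T \<in> {T. junction_tree G T}"
  then have T: "junction_tree G T" "pair_graph T" "pverts T = cliques G"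
    by (auto simp: junction_tree_def undirected_tree_def)
  then obtain L where L: "L \<subseteq> all_pairs (cliques G)" "T = link_graph (cliques G) L"
    using pair_graph_eq_link_graph by metis
  then show "T \<in> link_graph (cliques G) ` {L. junction_links (cliques G) L}"
    using T(1) junction_tree_link_graph[OF assms L(1)] by auto
next
  fix T assume "T \<in> link_graph (cliques G) ` {L. junction_links (cliques G) L}"
  then obtain L where L: "junction_links (cliques G) L" "T = link_graph (cliques G) L" by auto
  then show "T \<in> {T. junction_tree G T}"
    using junction_tree_link_graph[OF assms, of L] by (simp add: junction_links_def)
qed

lemma num_junction_trees_eq:
  assumes "finite (cliques G)"
  shows "num_junction_trees G = card {L. junction_links (cliques G) L}"
  unfolding num_junction_trees_def junction_trees_eq[OF assms]
  by (rule card_image, rule inj_onI)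
     (rule link_graph_inj[of _ "cliques G" _ "cliques G"], auto simp: junction_links_def)

lemma links_with_separator_link_graph:
  assumes "L \<subseteq> all_pairs K"
  shows "links_with_separator (link_graph K L) s = {e \<in> L. \<Inter>e = s}"
proof (intro equalityI subsetI)
  fix e assume "e \<in> links_with_separator (link_graph K L) s"
  then show "e \<in> {e \<in> L. \<Inter>e = s}"
    by (auto simp: links_with_separator_def edge_rel_def)
next
  fix e assume e: "e \<in> {e \<in> L. \<Inter>e = s}"
  then have "e \<in> all_pairs K" using assms by blast
  then obtain a b where "e = {a, b}" by (rule all_pairsE)
  then show "e \<in> links_with_separator (link_graph K L) s"
    using e unfolding links_with_separator_def by (auto simp: edge_rel_def)
qed

text \<open>The arcs left in the separator forest are the links strictly above \<open>s\<close>, so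
  its strongly connected components are the blocks of \<open>sep_rel K s\<close>.\<close>

lemma nu_tree_link_graph:
  assumes "finite K" "junction_links K L"
  shows "nu_tree (link_graph K L) s = family_nu K s"
proof -
  let ?T = "link_graph K L" and ?H = "separator_forest (link_graph K L) s"
  have L: "L \<subseteq> all_pairs K" using assms(2) by (simp add: junction_links_def)
  have sub: "edge_rel L \<subseteq> K \<times> K" by (rule edge_rel_sub[OF L])
  have st: "verts (separator_subtree ?T s) = containing K s"
    by (simp add: separator_subtree_def containing_def induce_subgraph_def)
  have vH: "verts ?H = containing K s" "tail ?H = fst" "head ?H = snd"
    by (simp_all add: separator_forest_def separator_subtree_def containing_def induce_subgraph_def)
  have "arcs ?H = {(a, b) \<in> edge_rel L. s \<subseteq> a \<and> s \<subseteq> b \<and> a \<inter> b \<noteq> s}"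
    using sub by (auto simp: separator_forest_def separator_subtree_def induce_subgraph_def)
  also have "\<dots> = edge_rel {e \<in> L. s \<subset> \<Inter>e}" by (auto simp: edge_rel_def)
  finally have aH: "arcs ?H = edge_rel {e \<in> L. s \<subset> \<Inter>e}" .
  have eH: "arcs_ends ?H = edge_rel {e \<in> L. s \<subset> \<Inter>e}"
    by (simp add: arcs_ends_conv aH vH)
  have "edge_rel {e \<in> L. s \<subset> \<Inter>e} \<subseteq> containing K s \<times> containing K s"
    using sub by (auto simp: edge_rel_def containing_def)
  then have "wf_digraph ?H" by unfold_locales (auto simp: aH vH)
  then have "pre_digraph.sccs_verts ?H = containing K s // eqcl (sep_rel K s)"
    using sccs_verts_eq[of ?H] sym_edge_rel unfolding eH vH eqcl_strict_links[OF assms(2)] by blast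
  moreover have "card (links_with_separator ?T s) - 1 = num_parts K s - 2"
    unfolding links_with_separator_link_graph[OF L] card_links_eq_num_parts[OF assms] by simp
  ultimately show ?thesis unfolding nu_tree_def st family_nu_def by simp
qed

section \<open>Graph invariants in terms of the family of cliques\<close>

lemma finite_cliques:
  assumes "finite (pverts G)" shows "finite (cliques G)" "finite (\<Union>(cliques G))"
proof -
  have "cliques G \<subseteq> Pow (pverts G)" by (auto simp: cliques_def complete_in_def)
  then show "finite (cliques G)" "finite (\<Union>(cliques G))"
    using assms by (auto intro: finite_subset)
qed

lemma decomposable_finite_verts: "G \<in> decomposable_graphs V \<Longrightarrow> finite (pverts G)"
  by (auto simp: decomposable_graphs_def pair_graph_def pair_digraph_def
        pair_fin_digraph_def pair_fin_digraph_axioms_def)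

context
  fixes G :: "'a pair_pre_digraph" and V
  assumes dec: "G \<in> decomposable_graphs V"
begin

lemma decomposable_finite: "finite (cliques G)" "finite (\<Union>(cliques G))"
  using finite_cliques[OF decomposable_finite_verts[OF dec]] by auto

lemma decomposable_junction_links: obtains L where "junction_links (cliques G) L"
proof -
  obtain T where "T \<in> {T. junction_tree G T}" using dec by (auto simp: decomposable_graphs_def)
  then show thesis using that unfolding junction_trees_eq[OF decomposable_finite(1)] by blast
qed

lemma all_junction_trees:
  "(\<forall>T. junction_tree G T \<longrightarrow> P T) \<longleftrightarrow>
   (\<forall>L. junction_links (cliques G) L \<longrightarrow> P (link_graph (cliques G) L))"
proof -
  have "(\<forall>T. junction_tree G T \<longrightarrow> P T) \<longleftrightarrow> (\<forall>T\<in>{T. junction_tree G T}. P T)" by simp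
  then show ?thesis unfolding junction_trees_eq[OF decomposable_finite(1)] by simp
qed

lemma separators_eq: "separators G = family_separators (cliques G)"
proof -
  obtain L0 where L0: "junction_links (cliques G) L0" by (rule decomposable_junction_links)
  have *: "links_with_separator (link_graph (cliques G) L) s = {} \<longleftrightarrow> s \<notin> family_separators (cliques G)"
    if "junction_links (cliques G) L" for L s
    unfolding links_with_separator_link_graph[OF junction_links_sub[OF that]]
      family_separators_eq[OF decomposable_finite(1) that] by blast
  have "s \<notin> separators G \<longleftrightarrow> s \<notin> family_separators (cliques G)" for s
  proof -
    have "s \<notin> separators G \<longleftrightarrow> (\<forall>T. junction_tree G T \<longrightarrow> links_with_separator T s = {})"
      unfolding separators_def by blast
    also have "\<dots> \<longleftrightarrow> s \<notin> family_separators (cliques G)"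
      unfolding all_junction_trees using L0 by (auto simp: *)
    finally show ?thesis .
  qed
  then show ?thesis by blast
qed

text \<open>All link sets give this value, and some link set exists; over an empty set of junction
  trees every number would fit the description and \<open>THE\<close> would determine
  nothing.\<close>

lemma multiplicity_eq: "multiplicity G s = num_parts (cliques G) s - 1"
proof -
  obtain L0 where L0: "junction_links (cliques G) L0" by (rule decomposable_junction_links)
  have "card (links_with_separator (link_graph (cliques G) L) s) = num_parts (cliques G) s - 1"
    if "junction_links (cliques G) L" for L
    unfolding links_with_separator_link_graph[OF junction_links_sub[OF that]]
    by (rule card_links_eq_num_parts[OF decomposable_finite(1) that])
  then show ?thesis
    unfolding multiplicity_def all_junction_trees using L0 by (intro the_equality) blast+
qed

lemma nu_eq: "nu G s = family_nu (cliques G) s"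
proof -
  obtain L0 where L0: "junction_links (cliques G) L0" by (rule decomposable_junction_links)
  have "nu_tree (link_graph (cliques G) L) s = family_nu (cliques G) s"
    if "junction_links (cliques G) L" for L
    by (rule nu_tree_link_graph[OF decomposable_finite(1) that])
  then show ?thesis
    unfolding nu_def all_junction_trees using L0 by (intro the_equality) blast+
qed

lemma finite_separators: "finite (separators G)"
  unfolding separators_eq
  using decomposable_junction_links finite_family_separators[OF decomposable_finite(1)] by blast

theorem num_junction_trees_prod: "num_junction_trees G = (\<Prod>s\<in>separators G. nu G s)"
proof -
  obtain L0 where L0: "junction_links (cliques G) L0" by (rule decomposable_junction_links)
  show ?thesis
    unfolding num_junction_trees_eq[OF decomposable_finite(1)] separators_eq nu_eq
    by (rule card_junction_links[OF decomposable_finite L0])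
qed

end

section \<open>Expansions\<close>

lemma eqcl_map:
  assumes "(a, b) \<in> eqcl r" "\<And>x y. (x, y) \<in> r \<Longrightarrow> (f x, f y) \<in> eqcl q"
  shows "(f a, f b) \<in> eqcl q"
  using assms(1)
proof (induction rule: eqcl_induct)
  case refl then show ?case by simp
next
  case (step u v)
  show ?case by (rule eqcl_trans[OF step(3) assms(2)[OF step(2)]])
next
  case (conv u v)
  show ?case by (rule eqcl_trans[OF conv(3) eqcl_sym[OF assms(2)[OF conv(2)]]])
qed

text \<open>Compatibility is required for distinct points only, because loops do not affect the
  closure. This is essential later: replacing \<open>k\<close> by \<open>insert v k\<close>
  preserves intersections of distinct cliques but not that of \<open>k\<close> with itself.\<close>

lemma eqcl_bij_iff:
  assumes bij: "bij_betw f W W'" and sub: "r \<subseteq> W \<times> W" "r' \<subseteq> W' \<times> W'"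
    and rel: "\<And>a b. a \<in> W \<Longrightarrow> b \<in> W \<Longrightarrow> a \<noteq> b \<Longrightarrow> (a, b) \<in> r \<longleftrightarrow> (f a, f b) \<in> r'"
    and ab: "a \<in> W" "b \<in> W"
  shows "(f a, f b) \<in> eqcl r' \<longleftrightarrow> (a, b) \<in> eqcl r"
proof
  let ?g = "inv_into W f"
  assume "(f a, f b) \<in> eqcl r'"
  then have "(?g (f a), ?g (f b)) \<in> eqcl r"
  proof (rule eqcl_map)
    fix x y assume xy: "(x, y) \<in> r'"
    then have "x \<in> f ` W" "y \<in> f ` W" using sub(2) bij by (auto simp: bij_betw_def)
    then have g: "?g x \<in> W" "?g y \<in> W" "f (?g x) = x" "f (?g y) = y"
      by (auto simp: inv_into_into f_inv_into_f)
    show "(?g x, ?g y) \<in> eqcl r"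
    proof (cases "?g x = ?g y")
      case False
      then have "(?g x, ?g y) \<in> r" using rel[OF g(1,2)] g xy by simp
      then show ?thesis by (rule eqcl_base)
    qed simp
  qed
  moreover have "inj_on f W" using bij by (simp add: bij_betw_def)
  ultimately show "(a, b) \<in> eqcl r" using ab by simp
next
  assume "(a, b) \<in> eqcl r"
  then show "(f a, f b) \<in> eqcl r'"
  proof (rule eqcl_map)
    fix x y assume xy: "(x, y) \<in> r"
    show "(f x, f y) \<in> eqcl r'"
    proof (cases "x = y")
      case False
      then have "(f x, f y) \<in> r'" using rel[of x y] xy sub(1) by auto
      then show ?thesis by (rule eqcl_base)
    qed simp
  qed
qed

lemma quotient_bij:
  assumes bij: "bij_betw f W W'" and sub: "r \<subseteq> W \<times> W" "r' \<subseteq> W' \<times> W'"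
    and rel: "\<And>a b. a \<in> W \<Longrightarrow> b \<in> W \<Longrightarrow> a \<noteq> b \<Longrightarrow> (a, b) \<in> r \<longleftrightarrow> (f a, f b) \<in> r'"
  shows "num_classes W' r' = num_classes W r"
    and "(\<Prod>C\<in>W' // eqcl r'. card C) = (\<Prod>C\<in>W // eqcl r. card C)"
proof -
  have inj: "inj_on f W" and img: "f ` W = W'" using bij by (auto simp: bij_betw_def)
  have iff: "(f a, f b) \<in> eqcl r' \<longleftrightarrow> (a, b) \<in> eqcl r" if "a \<in> W" "b \<in> W" for a b
    using eqcl_bij_iff[OF bij sub _ that] rel by simp
  have cls: "eqcl r' `` {f a} = f ` (eqcl r `` {a})" if a: "a \<in> W" for a
  proof (intro equalityI subsetI)
    fix y assume y: "y \<in> eqcl r' `` {f a}"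
    have "f a \<in> W'" using a img by blast
    then have "y \<in> W'" using y class_subset[OF sub(2)] by blast
    then obtain b where b: "b \<in> W" "y = f b" using img by blast
    then have "(a, b) \<in> eqcl r" using y iff[OF a] by simp
    then show "y \<in> f ` (eqcl r `` {a})" using b by blast
  next
    fix y assume "y \<in> f ` (eqcl r `` {a})"
    then obtain b where b: "(a, b) \<in> eqcl r" "y = f b" by blast
    then have "b \<in> W" using class_subset[OF sub(1) a] by blast
    then show "y \<in> eqcl r' `` {f a}" using b iff[OF a] by simp
  qed
  have Q: "W' // eqcl r' = image f ` (W // eqcl r)"
    unfolding quotient_image img[symmetric] image_image using cls by (rule image_cong[OF refl])
  have subW: "C \<subseteq> W" if "C \<in> W // eqcl r" for C
    using that class_subset[OF sub(1)] by (auto simp: quotient_image)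
  have injQ: "inj_on (image f) (W // eqcl r)"
    using subW inj by (intro inj_onI) (simp add: inj_on_image_eq_iff)
  show "num_classes W' r' = num_classes W r"
    unfolding num_classes_def Q by (rule card_image[OF injQ])
  have "card (f ` C) = card C" if "C \<in> W // eqcl r" for C
    using subW[OF that] inj by (intro card_image) (rule inj_on_subset)
  then show "(\<Prod>C\<in>W' // eqcl r'. card C) = (\<Prod>C\<in>W // eqcl r. card C)"
    unfolding Q prod.reindex[OF injQ] by (intro prod.cong) simp_all
qed

lemma family_nu_bij:
  assumes bij: "bij_betw f (containing K s) (containing K' s)"
    and rel: "\<And>a b. a \<in> containing K s \<Longrightarrow> b \<in> containing K s \<Longrightarrow> a \<noteq> b \<Longrightarrow> f a \<inter> f b = a \<inter> b"
  shows "num_parts K' s = num_parts K s" "family_nu K' s = family_nu K s"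
proof -
  have iff: "(a, b) \<in> sep_rel K s \<longleftrightarrow> (f a, f b) \<in> sep_rel K' s"
    if "a \<in> containing K s" "b \<in> containing K s" "a \<noteq> b" for a b
  proof -
    have "f a \<in> containing K' s" "f b \<in> containing K' s" using bij that by (auto simp: bij_betw_def)
    then show ?thesis using that rel[OF that] by (simp add: sep_rel_def containing_def)
  qed
  note Q = quotient_bij[OF bij sep_rel_sub sep_rel_sub iff]
  show p: "num_parts K' s = num_parts K s" unfolding num_parts_def by (rule Q(1))
  show "family_nu K' s = family_nu K s"
    using Q(2) bij_betw_same_card[OF bij] by (simp add: family_nu_def p)
qed

text \<open>The point \<open>c\<close> is related to nothing in \<open>W\<close>, so it is a class
  of its own. The loop \<open>(c, c)\<close> appears because in the application the new clique
  properly contains the set under consideration.\<close>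

lemma num_classes_isolated:
  assumes "finite W" "r \<subseteq> W \<times> W" "c \<notin> W"
  shows "num_classes (insert c W) (insert (c, c) r) = Suc (num_classes W r)"
proof -
  have eq: "eqcl (insert (c, c) r) = eqcl r" by (rule eqcl_insert_redundant) simp
  have "eqcl r `` {c} \<inter> W = {}"
  proof -
    have False if "(c, x) \<in> eqcl r" "x \<in> W" for x
      using eqcl_closed[OF eqcl_sym[OF that(1)] assms(2) that(2)] assms(3) by blast
    then show ?thesis by blast
  qed
  moreover have "C \<subseteq> W" "C \<noteq> {}" if "C \<in> W // eqcl r" for C
    using that class_subset[OF assms(2)] by (auto simp: quotient_image)
  ultimately have "eqcl r `` {c} \<notin> W // eqcl r" by blast
  moreover have "insert c W // eqcl r = insert (eqcl r `` {c}) (W // eqcl r)"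
    by (simp add: quotient_image)
  moreover have "finite (W // eqcl r)" using assms(1) by (simp add: quotient_image)
  ultimately show ?thesis by (simp add: num_classes_def eq)
qed

text \<open>Ensures that the denominator of the ratio formula is nonzero.\<close>

lemma family_nu_pos:
  assumes "finite K" "s \<in> family_separators K" shows "family_nu K s > 0"
proof -
  have "containing K s // eqcl (sep_rel K s) \<noteq> {}"
    using assms(2) unfolding family_separators_def num_parts_def num_classes_def by auto
  then have "containing K s \<noteq> {}" by (auto simp: quotient_image)
  then have "card (containing K s) > 0" using assms(1) by (simp add: card_gt_0_iff)
  moreover have "card C > 0" if C: "C \<in> containing K s // eqcl (sep_rel K s)" for C
  proof -
    have "C \<subseteq> containing K s" "C \<noteq> {}"
      using C class_subset[OF sep_rel_sub] by (auto simp: quotient_image)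
    then show ?thesis using assms(1) by (simp add: card_gt_0_iff finite_subset)
  qed
  ultimately show ?thesis unfolding family_nu_def by (simp add: prod_pos)
qed

section \<open>Cliques of the expanded graph\<close>

lemma complete_in_extend:
  assumes "finite (pverts H)" "complete_in H C"
  obtains D where "D \<in> cliques H" "C \<subseteq> D"
proof -
  let ?S = "{D. complete_in H D}"
  have "?S \<subseteq> Pow (pverts H)" by (auto simp: complete_in_def)
  then have "finite ?S" using assms(1) finite_subset by blast
  then obtain D where D: "complete_in H D" "C \<subseteq> D" "\<forall>E. complete_in H E \<longrightarrow> D \<subseteq> E \<longrightarrow> D = E"
    using finite_has_maximal2[of ?S C] assms(2) by auto
  then have "D \<in> cliques H" unfolding cliques_def by blast
  then show thesis using D(2) by (rule that)
qed

lemma cliques_complete: "c \<in> cliques H \<Longrightarrow> complete_in H c"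
  by (simp add: cliques_def)

lemma cliques_maximal: "c \<in> cliques H \<Longrightarrow> complete_in H d \<Longrightarrow> c \<subseteq> d \<Longrightarrow> d = c"
  by (simp add: cliques_def)

lemma complete_in_subset: "complete_in H c \<Longrightarrow> d \<subseteq> c \<Longrightarrow> complete_in H d"
  by (auto simp: complete_in_def)

context
  fixes G G' :: "'a pair_pre_digraph" and v V V'
  assumes dec: "G \<in> decomposable_graphs V" and dec': "G' \<in> decomposable_graphs V'"
    and ex: "expansion G v G'"
begin

lemma complete_in_expansion: "complete_in G c \<longleftrightarrow> complete_in G' c \<and> v \<notin> c"
proof -
  have "v \<notin> pverts G" "pverts G' = insert v (pverts G)"
    "parcs G = {e \<in> parcs G'. fst e \<in> pverts G \<and> snd e \<in> pverts G}"
    using ex by (auto simp: expansion_def induced_subgraph_def)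
  then show ?thesis unfolding complete_in_def by auto
qed

lemma clique_of_expansion:
  assumes "c \<in> cliques G'" "v \<notin> c" shows "c \<in> cliques G"
  using assms by (auto simp: cliques_def complete_in_expansion)

text \<open>Only the new vertex can enlarge an old clique, and then adding \<open>v\<close> alone
  would already give a complete set.\<close>

lemma clique_in_expansion:
  assumes "c \<in> cliques G" "\<not> complete_in G' (insert v c)" shows "c \<in> cliques G'"
proof -
  have c: "complete_in G' c" "v \<notin> c" using cliques_complete[OF assms(1)] complete_in_expansion by auto
  have "d = c" if d: "complete_in G' d" "c \<subseteq> d" for d
  proof (cases "v \<in> d")
    case True
    then have "complete_in G' (insert v c)" using d by (intro complete_in_subset[OF d(1)]) auto
    then show ?thesis using assms(2) by blast
  next
    case False
    then show ?thesis using d cliques_maximal[OF assms(1)] complete_in_expansion by auto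
  qed
  then show ?thesis using c by (simp add: cliques_def)
qed

text \<open>The multiplicities are truncated differences \<open>num_parts - 1\<close>. At least two
  parts in \<open>G'\<close> express that \<open>s\<close> is a separator there and allow the
  comparison without subtraction, even when \<open>G\<close> has no part at all.\<close>

lemma created_iff:
  "s \<in> created_separators G G' \<longleftrightarrow>
    2 \<le> num_parts (cliques G') s \<and> num_parts (cliques G) s < num_parts (cliques G') s"
  unfolding created_separators_def separators_eq[OF dec'] multiplicity_eq[OF dec]
    multiplicity_eq[OF dec'] family_separators_def by auto

lemma clique_old: "c \<in> cliques G \<Longrightarrow> v \<notin> c"
  using cliques_complete complete_in_expansion by blast

lemma num_parts_new:
  assumes "v \<in> s" shows "num_parts (cliques G) s = 0"
proof -
  have "containing (cliques G) s = {}" using clique_old assms by (auto simp: containing_def)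
  then show ?thesis by (simp add: num_parts_def num_classes_def quotient_image)
qed

section \<open>Sets contained in no created separator\<close>

context
  fixes s assumes not_below: "\<And>s'. s' \<in> created_separators G G' \<Longrightarrow> \<not> s \<subseteq> s'"
begin

text \<open>Otherwise a junction tree has a link above \<open>C \<inter> D\<close>. Its separator
  contains \<open>v\<close>, which no old clique does, so it is created and lies above
  \<open>s\<close>.\<close>

lemma clique_containing_new_unique:
  assumes C: "C \<in> cliques G'" "insert v s \<subseteq> C" and D: "D \<in> cliques G'" "insert v s \<subseteq> D"
  shows "C = D"
proof (rule ccontr)
  assume "C \<noteq> D"
  obtain L where L: "junction_links (cliques G') L" by (rule decomposable_junction_links[OF dec'])
  have "(C, D) \<in> eqcl (edge_rel {e \<in> L. C \<inter> D \<subseteq> \<Inter>e})"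
    by (rule junction_links_conn[OF L]) (use C D in \<open>auto simp: containing_def\<close>)
  then have "{e \<in> L. C \<inter> D \<subseteq> \<Inter>e} \<noteq> {}" using \<open>C \<noteq> D\<close> by (metis edge_rel_empty eqcl_empty pair_in_Id_conv)
  then obtain e where e: "e \<in> L" "C \<inter> D \<subseteq> \<Inter>e" by blast
  have "\<Inter>e \<in> family_separators (cliques G')"
    using family_separators_eq[OF decomposable_finite(1)[OF dec'] L] e(1) by blast
  moreover have sub: "insert v s \<subseteq> \<Inter>e" using C D e by blast
  ultimately have "\<Inter>e \<in> created_separators G G'"
    using num_parts_new[of "\<Inter>e"] unfolding created_iff family_separators_def by auto
  then show False using not_below sub by blast
qed

text \<open>Either no clique contains both \<open>s\<close> and \<open>v\<close>, and the cliques
  containing \<open>s\<close> are unchanged, or exactly one does, and it takes the place of an old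
  clique with the same intersections.\<close>

lemma family_nu_expansion:
  assumes "v \<notin> s"
  shows "num_parts (cliques G') s = num_parts (cliques G) s \<and>
    family_nu (cliques G') s = family_nu (cliques G) s"
proof (cases "\<exists>C\<in>cliques G'. insert v s \<subseteq> C")
  case False
  have "containing (cliques G') s = containing (cliques G) s"
  proof (intro equalityI subsetI)
    fix c assume "c \<in> containing (cliques G') s"
    then show "c \<in> containing (cliques G) s"
      using False clique_of_expansion by (auto simp: containing_def)
  next
    fix c assume c: "c \<in> containing (cliques G) s"
    have "\<not> complete_in G' (insert v c)"
    proof
      assume "complete_in G' (insert v c)"
      then obtain D where "D \<in> cliques G'" "insert v c \<subseteq> D"
        by (rule complete_in_extend[OF decomposable_finite_verts[OF dec']])
      then show False using False c by (auto simp: containing_def)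
    qed
    then show "c \<in> containing (cliques G') s"
      using c clique_in_expansion by (auto simp: containing_def)
  qed
  then have bij: "bij_betw id (containing (cliques G) s) (containing (cliques G') s)"
    by (simp add: bij_betw_def)
  show ?thesis using family_nu_bij[OF bij] by simp
next
  case True
  then obtain C where C: "C \<in> cliques G'" "insert v s \<subseteq> C" by blast
  define k where "k = C - {v}"
  have Ck: "C = insert v k" "v \<notin> k" "s \<subseteq> k" using C assms by (auto simp: k_def)
  have kc: "complete_in G k"
    using complete_in_subset[OF cliques_complete[OF C(1)], of k] complete_in_expansion Ck by auto
  have new: "c = C" if "c \<in> cliques G'" "s \<subseteq> c" "v \<in> c" for c
    using clique_containing_new_unique[OF that(1) _ C] that by blast
  have old: "c \<in> cliques G'" if c: "c \<in> cliques G" "s \<subseteq> c" "c \<noteq> k" for c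
  proof (rule clique_in_expansion[OF c(1)], rule notI)
    assume "complete_in G' (insert v c)"
    then obtain D where D: "D \<in> cliques G'" "insert v c \<subseteq> D"
      by (rule complete_in_extend[OF decomposable_finite_verts[OF dec']])
    then have "D = C" using c(2) by (intro new) auto
    then have "c \<subseteq> k" using D(2) clique_old[OF c(1)] by (auto simp: k_def)
    then show False using cliques_maximal[OF c(1) kc] c(3) by blast
  qed
  \<comment> \<open>If \<open>k\<close> were not a clique, the old cliques containing
    \<open>k\<close> would all persist and meet \<open>C\<close> only in \<open>k\<close>. Then
    \<open>C\<close> would be an additional block over \<open>k\<close>, and \<open>k\<close> a
    created separator above \<open>s\<close>.\<close>
  have k: "k \<in> cliques G"
  proof (rule ccontr)
    assume nk: "k \<notin> cliques G"
    let ?W = "containing (cliques G) k"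
    have Cn: "C \<notin> ?W" using clique_old[of C] Ck by (auto simp: containing_def)
    have W: "containing (cliques G') k = insert C ?W"
    proof (intro equalityI subsetI)
      fix c assume "c \<in> containing (cliques G') k"
      then show "c \<in> insert C ?W"
        using new[of c] clique_of_expansion[of c] Ck(3) by (auto simp: containing_def)
    next
      fix c assume "c \<in> insert C ?W"
      then show "c \<in> containing (cliques G') k"
        using C(1) old[of c] Ck nk by (auto simp: containing_def)
    qed
    have "C \<inter> c = k" "c \<inter> C = k" if "c \<in> ?W" for c
      using that clique_old[of c] Ck by (auto simp: containing_def)
    \<comment> \<open>The loop at \<open>C\<close> is the only new pair, as \<open>C\<close>
      properly contains \<open>k\<close>.\<close>
    then have R: "(a, b) \<in> sep_rel (cliques G') k \<longleftrightarrow> (a, b) \<in> insert (C, C) (sep_rel (cliques G) k)" for a b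
    proof -
      have "(a, b) \<in> sep_rel (cliques G') k \<longleftrightarrow> a \<in> insert C ?W \<and> b \<in> insert C ?W \<and> k \<subset> a \<inter> b"
        unfolding W[symmetric] by (auto simp: sep_rel_def containing_def)
      also have "\<dots> \<longleftrightarrow> (a, b) = (C, C) \<or> a \<in> ?W \<and> b \<in> ?W \<and> k \<subset> a \<inter> b"
        using \<open>\<And>c. c \<in> ?W \<Longrightarrow> C \<inter> c = k\<close> \<open>\<And>c. c \<in> ?W \<Longrightarrow> c \<inter> C = k\<close> Ck Cn by auto
      also have "\<dots> \<longleftrightarrow> (a, b) \<in> insert (C, C) (sep_rel (cliques G) k)"
        by (auto simp: sep_rel_def containing_def)
      finally show ?thesis .
    qed
    have finW: "finite ?W" using decomposable_finite(1)[OF dec] by simp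
    have "sep_rel (cliques G') k = insert (C, C) (sep_rel (cliques G) k)"
      using R by (intro set_eqI) (metis surj_pair)
    then have Suc: "num_parts (cliques G') k = Suc (num_parts (cliques G) k)"
      unfolding num_parts_def W by (simp only: num_classes_isolated[OF finW sep_rel_sub Cn])
    \<comment> \<open>Some old clique contains \<open>k\<close>, so there was a block before and
      there are now at least two, as a separator requires.\<close>
    obtain D where "D \<in> cliques G" "k \<subseteq> D"
      using complete_in_extend[OF decomposable_finite_verts[OF dec] kc] .
    then have "?W \<noteq> {}" by (auto simp: containing_def)
    then have "num_parts (cliques G) k > 0"
      using finW by (simp add: num_parts_def num_classes_def quotient_image card_gt_0_iff)
    then have "k \<in> created_separators G G'" unfolding created_iff using Suc by simp
    then show False using not_below Ck(3) by blast
  qed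
  \<comment> \<open>Old cliques avoid \<open>v\<close>, so enlarging just one of two distinct ones
    by \<open>v\<close> leaves their intersection unchanged.\<close>
  let ?f = "\<lambda>c. if c = k then C else c"
  have "bij_betw ?f (containing (cliques G) s) (containing (cliques G') s)"
  proof (rule bij_betw_byWitness[where f' = "\<lambda>c. if c = C then k else c"])
    have "C \<notin> cliques G" using clique_old[of C] Ck by auto
    then show "\<forall>c\<in>containing (cliques G) s. (if ?f c = C then k else ?f c) = c"
      by (auto simp: containing_def)
    have "k \<notin> cliques G'"
    proof
      assume "k \<in> cliques G'"
      then have "C = k" using cliques_maximal[of k G' C] cliques_complete[OF C(1)] Ck by auto
      then show False using Ck by auto
    qed
    then show "\<forall>c\<in>containing (cliques G') s. ?f (if c = C then k else c) = c"
      by (auto simp: containing_def)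
    show "?f ` containing (cliques G) s \<subseteq> containing (cliques G') s"
      using C old by (auto simp: containing_def)
    show "(\<lambda>c. if c = C then k else c) ` containing (cliques G') s \<subseteq> containing (cliques G) s"
      using k Ck(3) new clique_of_expansion by (auto simp: containing_def)
  qed
  moreover have "?f a \<inter> ?f b = a \<inter> b"
    if ab: "a \<in> containing (cliques G) s" "b \<in> containing (cliques G) s" "a \<noteq> b" for a b
  proof -
    have "v \<notin> a" "v \<notin> b" using ab clique_old by (auto simp: containing_def)
    then show ?thesis using ab(3) Ck(1) by simp
  qed
  ultimately show ?thesis using family_nu_bij[of ?f "cliques G" s "cliques G'"] by simp
qed

text \<open>If \<open>v \<in> s\<close>, then \<open>s\<close> is no separator of \<open>G\<close>,
  and as a separator of \<open>G'\<close> it would itself be created. For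
  \<open>v \<notin> s\<close> the block data agree.\<close>

lemma separators_nu_expansion:
  "s \<in> separators G' \<longleftrightarrow> s \<in> separators G" "s \<in> separators G \<Longrightarrow> nu G' s = nu G s"
proof -
  show iff: "s \<in> separators G' \<longleftrightarrow> s \<in> separators G"
  proof (cases "v \<in> s")
    case True
    then have "num_parts (cliques G) s = 0" by (rule num_parts_new)
    moreover have "s \<notin> created_separators G G'" using not_below by blast
    ultimately show ?thesis
      unfolding separators_eq[OF dec] separators_eq[OF dec'] created_iff family_separators_def by auto
  next
    case False
    then show ?thesis
      using family_nu_expansion
      unfolding separators_eq[OF dec] separators_eq[OF dec'] family_separators_def by simp
  qed
  assume s: "s \<in> separators G"
  have "v \<notin> s"
  proof
    assume "v \<in> s"
    then have "num_parts (cliques G) s = 0" by (rule num_parts_new)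
    then show False using s unfolding separators_eq[OF dec] family_separators_def by simp
  qed
  then show "nu G' s = nu G s" using family_nu_expansion unfolding nu_eq[OF dec] nu_eq[OF dec'] by blast
qed

end

text \<open>Both tree counts are products of \<open>nu\<close> over all separators. The factors not
  below a created separator coincide and cancel, and the remaining denominator is positive.\<close>

theorem num_junction_trees_expansion:
  "real (num_junction_trees G') =
     (\<Prod>s\<in>separators_below G' (created_separators G G'). real (nu G' s)) /
     (\<Prod>s\<in>separators_below G (created_separators G G'). real (nu G s)) *
     real (num_junction_trees G)"
proof -
  let ?S = "created_separators G G'"
  let ?A = "separators_below G ?S" and ?A' = "separators_below G' ?S"
  have sub: "?A \<subseteq> separators G" "?A' \<subseteq> separators G'" by (auto simp: separators_below_def)
  have rest: "separators G' - ?A' = separators G - ?A"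
  proof (intro set_eqI)
    fix s show "s \<in> separators G' - ?A' \<longleftrightarrow> s \<in> separators G - ?A"
      using separators_nu_expansion(1)[of s] unfolding separators_below_def by blast
  qed
  have "nu G' s = nu G s" if "s \<in> separators G - ?A" for s
    using that by (intro separators_nu_expansion(2)) (auto simp: separators_below_def)
  then have eq: "(\<Prod>s\<in>separators G' - ?A'. real (nu G' s)) = (\<Prod>s\<in>separators G - ?A. real (nu G s))"
    unfolding rest by (intro prod.cong) auto
  have "nu G s > 0" if "s \<in> ?A" for s
    using that sub(1) family_nu_pos[OF decomposable_finite(1)[OF dec], of s]
    unfolding nu_eq[OF dec] separators_eq[OF dec] by auto
  then have nz: "(\<Prod>s\<in>?A. real (nu G s)) \<noteq> 0"
    using finite_subset[OF sub(1) finite_separators[OF dec]] by (auto simp: prod_zero_iff)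
  have "real (num_junction_trees G) = (\<Prod>s\<in>separators G - ?A. real (nu G s)) * (\<Prod>s\<in>?A. real (nu G s))"
    unfolding num_junction_trees_prod[OF dec] of_nat_prod
    by (rule prod.subset_diff[OF sub(1) finite_separators[OF dec]])
  moreover have "real (num_junction_trees G') =
      (\<Prod>s\<in>separators G' - ?A'. real (nu G' s)) * (\<Prod>s\<in>?A'. real (nu G' s))"
    unfolding num_junction_trees_prod[OF dec'] of_nat_prod
    by (rule prod.subset_diff[OF sub(2) finite_separators[OF dec']])
  ultimately show ?thesis using nz unfolding eq by simp
qed

end

theorem theorem7:
  fixes y :: "nat \<Rightarrow> 'a" and m :: nat and G G' :: "'a pair_pre_digraph"
  assumes "inj_on y {1..}"
    and "m \<ge> 1"
    and "G \<in> decomposable_graphs (y ` {1..m})"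
    and "G' \<in> decomposable_graphs (y ` {1..m + 1})"
    and "expansion G (y (m + 1)) G'"
  shows "real (num_junction_trees G') =
           (\<Prod>s\<in>separators_below G' (created_separators G G'). real (nu G' s)) /
           (\<Prod>s\<in>separators_below G (created_separators G G'). real (nu G s)) *
           real (num_junction_trees G)"
  by (rule num_junction_trees_expansion[OF assms(3-5)])

end
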